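(* Suppose that $\delta$, $a$ and $b$ are positive numbers satisfying the condition $1<a\le b$. Assume that $(X,d,\mu)$ is in the class $\mathcal{X}_{a,b}^{\delta}$. Then there exist a positive number $\delta'$ and a spider's web $\widehat\Gamma$ in the class $\Upsilon_{a,b}^{\delta'}$ such that $(\widehat\Gamma,d_{\widehat\Gamma})$ is strictly roughly isometric to $(X,d)$.
   Context: Balls: $B_r(x):=\{y: d(x,y)<r\}$. $\delta$-hyperbolicity: with $(y,z)_x:=\frac12\big(d(x,y)+d(x,z)-d(y,z)\big)$, a metric space $(X,d)$ is $\delta$-hyperbolic if $(x,z)_w\ge\min\big((x,y)_w,(y,z)_w\big)-\delta$ for all $x,y,z,w\in X$. Length space: $(X,d)$ is a length space with strictly intrinsic metric $d$, i.e. $d(x,y)$ is the minimum of the lengths of the paths joining $x$ and $y$ (in particular any two points are connected by a shortest path). Locally doubling: a Borel measure $\mu$ on $(X,d)$ is locally doubling if for every $s>0$ there is $L_s$ with $\mu(B_{2r}(x))\le L_s\,\mu(B_r(x))$ for all $x\in X$ and $0<r\le s$. Growth condition: a measure $\mu$ on a metric space has $(a,b)$-pinched exponential growth at infinity if there exist positive constants $c,C$ such that $c\,a^r\le\mu(B_r(x))\le C\,b^r$ for all points $x$ and all $r\in[1,\infty)$. The class $\mathcal{X}_{a,b}^{\delta}$ consists of all connected noncompact complete $\delta$-hyperbolic length spaces $(X,d)$ (with $d$ strictly intrinsic), endowed with a locally doubling Borel measure $\mu$ with $(a,b)$-pinched exponential growth at infinity. Graphs: all graphs are undirected, connected, without self-loops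 and multi-edges, and every vertex has finitely many neighbours. A graph is identified with its vertex set; it carries the graph distance (minimum number of edges in a path) and the counting measure on vertices. A tree is such a graph without cycles; a rooted tree $\mathrm{T}$ has a distinguished vertex $o$. The level of a vertex $x$ is $d_{\mathrm{T}}(x,o)$; the predecessor $p(x)$ of $x\ne o$ is the unique neighbour $y$ of $x$ in $\mathrm{T}$ with $d_{\mathrm{T}}(y,o)=d_{\mathrm{T}}(x,o)-1$. Spider's web: a spider's web $\widehat\Gamma$ is a graph without self-loops obtained from a rooted tree $\mathrm{T}$ by adding a (possibly empty) new set of edges such that: (1) two vertices from different tree levels are never joined in $\widehat\Gamma$ by a new edge; (2) if two vertices of the same level are connected by an edge in $\widehat\Gamma$, then their predecessors either coincide or are neighbours in $\widehat\Gamma$. Its graph distance is denoted $d_{\widehat\Gamma}$. The class $\Upsilon_{a,b}^{\delta'}$ consists of all spider's webs $\widehat\Gamma$ such that $(\widehat\Gamma,d_{\widehat\Gamma})$ is $\delta'$-hyperbolic and the counting measure on $\widehat\Gamma$ has $(a,b)$-pinched exponential growth at infinity (with respect to $d_{\widehat\Gamma}$). Strict rough isometry: a map $\varphi:(Y,d_Y)\to(Y',d_{Y'})$ between metric spaces is a strict rough isometry if there is $\beta\ge0$ with $d_Y(x,y)-\beta\le d_{Y'}(\varphi(x),\varphi(y))\le d_Y(x,y)+\beta$ for all $x,y\in Y$, and $\sup\{d_{Y'}(\varphi(Y),y'):y'\in Y'\}<\infty$. Two metric spaces are strictly roughly isometric if there is a strict rough isometry from one to the other (this is an equivalence relation). 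*)

theory Defs
  imports "HOL-Analysis.Analysis"
begin

section \<open>Metric measure spaces\<close>

definition gromov_product :: "'a metric \<Rightarrow> 'a \<Rightarrow> 'a \<Rightarrow> 'a \<Rightarrow> real" where
  "gromov_product m x y z = (mdist m x y + mdist m x z - mdist m y z) / 2"

definition gromov_hyperbolic :: "real \<Rightarrow> 'a metric \<Rightarrow> bool" where
  "gromov_hyperbolic \<delta> m \<longleftrightarrow>
     (\<forall>x\<in>mspace m. \<forall>y\<in>mspace m. \<forall>z\<in>mspace m. \<forall>w\<in>mspace m.
        gromov_product m w x z
          \<ge> min (gromov_product m w x y) (gromov_product m w y z) - \<delta>)"

definition curve_length :: "'a metric \<Rightarrow> (real \<Rightarrow> 'a) \<Rightarrow> ereal" where
  "curve_length m g =
     Sup {ereal (\<Sum>i<n. mdist m (g (t i)) (g (t (Suc i)))) | (n :: nat) (t :: nat \<Rightarrow> real).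
            (\<forall>i\<le>n. t i \<in> {0..1}) \<and> (\<forall>i<n. t i \<le> t (Suc i))}"

definition curve_between :: "'a metric \<Rightarrow> 'a \<Rightarrow> 'a \<Rightarrow> (real \<Rightarrow> 'a) \<Rightarrow> bool" where
  "curve_between m x y g \<longleftrightarrow> pathin (mtopology_of m) g \<and> g 0 = x \<and> g 1 = y"

definition strictly_intrinsic :: "'a metric \<Rightarrow> bool" where
  "strictly_intrinsic m \<longleftrightarrow>
     (\<forall>x\<in>mspace m. \<forall>y\<in>mspace m.
        (\<exists>g. curve_between m x y g \<and> curve_length m g = ereal (mdist m x y)) \<and>
        (\<forall>g. curve_between m x y g \<longrightarrow> ereal (mdist m x y) \<le> curve_length m g))"

definition borel_measure_on :: "'a metric \<Rightarrow> 'a measure \<Rightarrow> bool" where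
  "borel_measure_on m \<mu> \<longleftrightarrow>
     space \<mu> = mspace m \<and>
     sets \<mu> = sigma_sets (mspace m) {U. openin (mtopology_of m) U}"

definition locally_doubling :: "'a metric \<Rightarrow> 'a measure \<Rightarrow> bool" where
  "locally_doubling m \<mu> \<longleftrightarrow>
     (\<forall>s::real. s > 0 \<longrightarrow>
        (\<exists>L::real. \<forall>x\<in>mspace m. \<forall>r. 0 < r \<and> r \<le> s \<longrightarrow>
           emeasure \<mu> (mball_of m x (2 * r)) \<le> ennreal L * emeasure \<mu> (mball_of m x r)))"

definition pinched_exp_growth :: "real \<Rightarrow> real \<Rightarrow> 'a metric \<Rightarrow> 'a measure \<Rightarrow> bool" where
  "pinched_exp_growth a b m \<mu> \<longleftrightarrow>
     (\<exists>c::real. \<exists>C::real. 0 < c \<and> 0 < C \<and>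
        (\<forall>x\<in>mspace m. \<forall>r\<ge>1.
           ennreal (c * a powr r) \<le> emeasure \<mu> (mball_of m x r) \<and>
           emeasure \<mu> (mball_of m x r) \<le> ennreal (C * b powr r)))"

definition class_X :: "real \<Rightarrow> real \<Rightarrow> real \<Rightarrow> 'a metric \<Rightarrow> 'a measure \<Rightarrow> bool" where
  "class_X \<delta> a b m \<mu> \<longleftrightarrow>
     connected_space (mtopology_of m) \<and>
     \<not> compact_space (mtopology_of m) \<and>
     mcomplete_of m \<and>
     gromov_hyperbolic \<delta> m \<and>
     strictly_intrinsic m \<and>
     borel_measure_on m \<mu> \<and>
     locally_doubling m \<mu> \<and>
     pinched_exp_growth a b m \<mu>"

text \<open>The supremum of the distances from points of the target to the image is taken in the
  extended reals, so that the distance to an empty image is infinite.\<close>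

definition strict_rough_isometry :: "'a metric \<Rightarrow> 'b metric \<Rightarrow> ('a \<Rightarrow> 'b) \<Rightarrow> bool" where
  "strict_rough_isometry m m' \<phi> \<longleftrightarrow>
     \<phi> ` mspace m \<subseteq> mspace m' \<and>
     (\<exists>\<beta>\<ge>0. \<forall>x\<in>mspace m. \<forall>y\<in>mspace m.
        mdist m x y - \<beta> \<le> mdist m' (\<phi> x) (\<phi> y) \<and>
        mdist m' (\<phi> x) (\<phi> y) \<le> mdist m x y + \<beta>) \<and>
     (SUP y'\<in>mspace m'. INF x\<in>mspace m. ereal (mdist m' (\<phi> x) y')) < \<infinity>"

definition strictly_roughly_isometric :: "'a metric \<Rightarrow> 'b metric \<Rightarrow> bool" where
  "strictly_roughly_isometric m m' \<longleftrightarrow> (\<exists>\<phi>. strict_rough_isometry m m' \<phi>)"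


section \<open>Graphs\<close>

text \<open>A graph is given by its vertex set \<open>V\<close> and its set \<open>E\<close> of edges, an edge being the
  two-element set of its endpoints; this excludes orientations, self-loops and multi-edges.\<close>

definition graph_walk :: "'v set \<Rightarrow> 'v set set \<Rightarrow> 'v \<Rightarrow> 'v \<Rightarrow> 'v list \<Rightarrow> bool" where
  "graph_walk V E x y p \<longleftrightarrow>
     p \<noteq> [] \<and> set p \<subseteq> V \<and> hd p = x \<and> last p = y \<and> successively (\<lambda>u v. {u, v} \<in> E) p"

definition connected_graph :: "'v set \<Rightarrow> 'v set set \<Rightarrow> bool" where
  "connected_graph V E \<longleftrightarrow>
     V \<noteq> {} \<and>
     E \<subseteq> {{x, y} | x y. x \<in> V \<and> y \<in> V \<and> x \<noteq> y} \<and>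
     (\<forall>x\<in>V. finite {y. {x, y} \<in> E}) \<and>
     (\<forall>x\<in>V. \<forall>y\<in>V. \<exists>p. graph_walk V E x y p)"

text \<open>A walk with vertex list \<open>p\<close> has \<open>length p - 1\<close> edges.\<close>

definition graph_dist :: "'v set \<Rightarrow> 'v set set \<Rightarrow> 'v \<Rightarrow> 'v \<Rightarrow> nat" where
  "graph_dist V E x y = (INF p\<in>{p. graph_walk V E x y p}. length p - 1)"

text \<open>Meaningful for connected graphs only: the typedef constructor \<open>metric\<close> requires an actual
  metric, which is established in \<open>Metric_space_graph_dist\<close> below.\<close>

definition graph_metric :: "'v set \<Rightarrow> 'v set set \<Rightarrow> 'v metric" where
  "graph_metric V E = metric (V, \<lambda>x y. real (graph_dist V E x y))"

definition graph_cycle :: "'v set set \<Rightarrow> 'v list \<Rightarrow> bool" where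
  "graph_cycle E p \<longleftrightarrow>
     3 \<le> length p \<and> distinct p \<and> successively (\<lambda>u v. {u, v} \<in> E) p \<and> {last p, hd p} \<in> E"

definition rooted_tree :: "'v set \<Rightarrow> 'v set set \<Rightarrow> 'v \<Rightarrow> bool" where
  "rooted_tree V T o' \<longleftrightarrow> connected_graph V T \<and> (\<nexists>p. graph_cycle T p) \<and> o' \<in> V"

definition level :: "'v set \<Rightarrow> 'v set set \<Rightarrow> 'v \<Rightarrow> 'v \<Rightarrow> nat" where
  "level V T o' x = graph_dist V T x o'"

definition predecessor :: "'v set \<Rightarrow> 'v set set \<Rightarrow> 'v \<Rightarrow> 'v \<Rightarrow> 'v" where
  "predecessor V T o' x = (THE y. {x, y} \<in> T \<and> level V T o' y + 1 = level V T o' x)"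

text \<open>In the second condition neither endpoint is the root, since the root is the only vertex of
  level \<open>0\<close> and there are no self-loops; so \<open>predecessor\<close> is only used where it is meaningful.\<close>

definition spiders_web :: "'v set \<Rightarrow> 'v set set \<Rightarrow> bool" where
  "spiders_web V E \<longleftrightarrow>
     connected_graph V E \<and>
     (\<exists>T o'. rooted_tree V T o' \<and> T \<subseteq> E \<and>
        (\<forall>x y. {x, y} \<in> E - T \<longrightarrow> level V T o' x = level V T o' y) \<and>
        (\<forall>x y. {x, y} \<in> E \<and> level V T o' x = level V T o' y \<longrightarrow>
           predecessor V T o' x = predecessor V T o' y \<or>
           {predecessor V T o' x, predecessor V T o' y} \<in> E))"

text \<open>Connected locally finite graphs are countable, so every spider's web has an isomorphic copy
  whose vertices are natural numbers.\<close>

definition class_Upsilon :: "real \<Rightarrow> real \<Rightarrow> real \<Rightarrow> 'v set \<Rightarrow> 'v set set \<Rightarrow> bool" where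
  "class_Upsilon \<delta>' a b V E \<longleftrightarrow>
     spiders_web V E \<and>
     gromov_hyperbolic \<delta>' (graph_metric V E) \<and>
     pinched_exp_growth a b (graph_metric V E) (count_space V)"


section \<open>The graph distance is a metric\<close>

lemma graph_walk_rev: "graph_walk V E x y p \<Longrightarrow> graph_walk V E y x (rev p)"
  by (auto simp: graph_walk_def hd_rev last_rev insert_commute)

lemma graph_dist_commute: "graph_dist V E x y = graph_dist V E y x"
proof -
  have "(\<lambda>p. length p - 1) ` {p. graph_walk V E x y p}
          \<subseteq> (\<lambda>p. length p - 1) ` {p. graph_walk V E y x p}" for x y
  proof safe
    fix p assume "graph_walk V E x y p"
    then show "length p - 1 \<in> (\<lambda>p. length p - 1) ` {p. graph_walk V E y x p}"
      by (intro image_eqI[where x = "rev p"]) (auto intro: graph_walk_rev)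
  qed
  then show ?thesis
    unfolding graph_dist_def by (metis (no_types, lifting) subset_antisym)
qed

lemma graph_dist_le: "graph_walk V E x y p \<Longrightarrow> graph_dist V E x y \<le> length p - 1"
  unfolding graph_dist_def by (rule cINF_lower) auto

lemma graph_dist_attained:
  assumes "connected_graph V E" "x \<in> V" "y \<in> V"
  obtains p where "graph_walk V E x y p" "graph_dist V E x y = length p - 1"
proof -
  let ?S = "(\<lambda>p. length p - 1) ` {p. graph_walk V E x y p}"
  have "?S \<noteq> {}"
    using assms unfolding connected_graph_def by blast
  then have "Inf ?S \<in> ?S"
    by (rule Inf_nat_def1)
  then show thesis
    using that unfolding graph_dist_def by blast
qed

lemma graph_walk_append:
  assumes "graph_walk V E x y p" "graph_walk V E y z q"
  shows "graph_walk V E x z (p @ tl q)"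
proof (cases q)
  case Nil
  then show ?thesis using assms by (simp add: graph_walk_def)
next
  case (Cons a q')
  then show ?thesis
    using assms by (cases q') (auto simp: graph_walk_def successively_append_iff)
qed

lemma Metric_space_graph_dist:
  assumes G: "connected_graph V E"
  shows "Metric_space V (\<lambda>x y. real (graph_dist V E x y))"
proof
  fix x y assume xy: "x \<in> V" "y \<in> V"
  show "real (graph_dist V E x y) = 0 \<longleftrightarrow> x = y"
  proof
    assume "real (graph_dist V E x y) = 0"
    then obtain p where "graph_walk V E x y p" "length p - 1 = 0"
      using graph_dist_attained[OF G xy] by (metis of_nat_eq_0_iff)
    then show "x = y"
      by (cases p) (auto simp: graph_walk_def)
  next
    assume "x = y"
    then have "graph_walk V E x y [x]"
      using xy by (simp add: graph_walk_def)
    from graph_dist_le[OF this] show "real (graph_dist V E x y) = 0"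
      by simp
  qed
next
  fix x y z assume xyz: "x \<in> V" "y \<in> V" "z \<in> V"
  obtain p where p: "graph_walk V E x y p" "graph_dist V E x y = length p - 1"
    using graph_dist_attained[OF G] xyz by blast
  obtain q where q: "graph_walk V E y z q" "graph_dist V E y z = length q - 1"
    using graph_dist_attained[OF G] xyz by blast
  have "p \<noteq> []" using p by (simp add: graph_walk_def)
  then have "length (p @ tl q) - 1 = (length p - 1) + (length q - 1)"
    by (cases p) auto
  then show "real (graph_dist V E x z) \<le> real (graph_dist V E x y) + real (graph_dist V E y z)"
    using graph_dist_le[OF graph_walk_append[OF p(1) q(1)]] p q by linarith
qed (auto simp: graph_dist_commute)

lemma
  assumes "connected_graph V E"
  shows mspace_graph_metric: "mspace (graph_metric V E) = V"
    and mdist_graph_metric: "mdist (graph_metric V E) = (\<lambda>x y. real (graph_dist V E x y))"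
  using Metric_space.mspace_metric[OF Metric_space_graph_dist[OF assms]]
    Metric_space.mdist_metric[OF Metric_space_graph_dist[OF assms]]
  by (simp_all add: graph_metric_def)

end

theory Submission
  imports Defs
begin

text \<open>
  Fix a point \<open>w\<close> of \<open>X\<close> and an integer \<open>h \<ge> 2 + 6 * \<delta>\<close>, and choose a maximal \<open>2\<close>-separated set of
  points in the spheres of radius \<open>0, h, 2 * h, \<dots>\<close> about \<open>w\<close>.  A point of this net on one sphere is
  joined to a point of the net on the preceding sphere that lies within \<open>2\<close> of a geodesic to \<open>w\<close>,
  and the edge is subdivided into \<open>h\<close> unit edges.  This gives a rooted tree.  Two points of
  the net on the same sphere are called adjacent when their distance is at most \<open>2 + 6 * \<delta>\<close>,
  and adjacency is copied along the subdivided edges.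

  By hyperbolicity, geodesics to \<open>w\<close> from points at distance at most \<open>2 * h\<close> are so close together
  after a step of length \<open>h\<close> that the parents of the points coincide or are adjacent
  (\<open>parents_near\<close>).  Since \<open>2 + 6 * \<delta> \<le> h\<close>, this applies to adjacent points, which makes the graph a
  spider's web, and to points with a common neighbour, so that \<open>h\<close> steps towards the root halve
  the length of horizontal walks.

  The map that sends a vertex on a subdivided edge to the endpoint of the edge farther from \<open>w\<close> is
  a strict rough isometry.  On the one hand, two vertices have equal or adjacent ancestors near
  the level given by the Gromov product of their points (\<open>ancestors_near\<close>, \<open>vertices_meet\<close>), so their
  distance in the graph is at most the distance in \<open>X\<close> plus a constant.  On the other hand, every
  walk can be replaced by one that is no longer, and that goes up, horizontally and down
  (\<open>walk_shape\<close>).  Moving the horizontal part up by \<open>h\<close> levels costs \<open>2 * h\<close> steps and halves its length,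
  so this part may be assumed to be shorter than \<open>4 * h\<close> (\<open>shorten_horizontal\<close>).  The vertical parts
  stay near geodesics of \<open>X\<close> with an error that does not accumulate (\<open>gp_p_iter\<close>), so the distance
  in \<open>X\<close> is at most the length of the walk plus a constant.

  Hyperbolicity passes through a strict rough isometry, because all Gromov products change by a
  bounded amount only.  For the growth, the numbers of points of the net in balls are compared
  with the measures of balls by packing and covering (\<open>pinched_exp_growth_transfer\<close>).  Packing also
  gives the local finiteness of the graph.
\<close>

section \<open>Walks and graph distance\<close>

lemma relpowp_map:
  assumes "\<And>x y. B x y \<Longrightarrow> B' (f x) (f y)"
  shows "(B ^^ n) x y \<Longrightarrow> (B' ^^ n) (f x) (f y)"
proof (induction n arbitrary: y)
  case (Suc n)
  then obtain z where "(B ^^ n) x z" "B z y" by auto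
  then show ?case using Suc.IH[of z] assms by (auto intro: relpowp_Suc_I)
qed auto

lemma graph_walk_Cons:
  assumes "graph_walk V E y z p" "x \<in> V" "{x, y} \<in> E"
  shows "graph_walk V E x z (x # p)"
  using assms by (cases p) (auto simp: graph_walk_def)

lemma graph_walk_Lipschitz:
  fixes f :: "'v \<Rightarrow> nat"
  assumes "\<And>x y. {x, y} \<in> E \<Longrightarrow> f x \<le> f y + 1"
  shows "graph_walk V E x y p \<Longrightarrow> f x \<le> f y + (length p - 1)"
proof (induction p arbitrary: x)
  case Nil
  then show ?case by (simp add: graph_walk_def)
next
  case (Cons a q)
  show ?case
  proof (cases q)
    case Nil
    with Cons.prems show ?thesis by (auto simp: graph_walk_def)
  next
    case (Cons b q')
    with Cons.prems have "a = x" "{x, b} \<in> E" "graph_walk V E b y q"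
      by (auto simp: graph_walk_def split: if_splits)
    then show ?thesis using Cons.IH[of b] assms[of x b] Cons by simp
  qed
qed

lemma graph_dist_triangle:
  assumes "connected_graph V E" "x \<in> V" "y \<in> V" "z \<in> V"
  shows "graph_dist V E x z \<le> graph_dist V E x y + graph_dist V E y z"
  using Metric_space.triangle[OF Metric_space_graph_dist[OF assms(1)] assms(2-4)]
  by linarith

lemma graph_dist_edge:
  assumes "{x, y} \<in> E" "x \<in> V" "y \<in> V"
  shows "graph_dist V E x y \<le> 1"
  using graph_dist_le[of V E x y "[x, y]"] assms by (simp add: graph_walk_def)

lemma graph_dist_self: "x \<in> V \<Longrightarrow> graph_dist V E x x = 0"
  using graph_dist_le[of V E x x "[x]"] by (simp add: graph_walk_def)

section \<open>Spider's webs from a parent map and a horizontal relation\<close>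

text \<open>A spider's web is presented by a root \<open>r\<close>, a level function, a total parent map \<open>P\<close> (the
  root being its own parent) and a relation \<open>B\<close> of horizontal adjacency.  \<open>B\<close> is taken to be
  reflexive, so that \<open>adj_parent\<close> is the second axiom of a spider's web: parents of
  neighbours on a level coincide or are neighbours.\<close>

locale radial_web =
  fixes V :: "'v set" and r :: 'v and lev :: "'v \<Rightarrow> nat"
    and P :: "'v \<Rightarrow> 'v" and B :: "'v \<Rightarrow> 'v \<Rightarrow> bool"
  assumes root_in: "r \<in> V"
    and parent_in: "v \<in> V \<Longrightarrow> P v \<in> V"
    and parent_root: "P r = r"
    and lev_root: "lev r = 0"
    and lev_parent: "v \<in> V \<Longrightarrow> v \<noteq> r \<Longrightarrow> lev v = Suc (lev (P v))"
    and finite_level: "finite {v \<in> V. lev v = n}"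
    and adj_in: "B u v \<Longrightarrow> u \<in> V"
    and adj_refl: "v \<in> V \<Longrightarrow> B v v"
    and adj_sym: "B u v \<Longrightarrow> B v u"
    and adj_lev: "B u v \<Longrightarrow> lev u = lev v"
    and adj_parent: "B u v \<Longrightarrow> B (P u) (P v)"
begin

definition tree_edges :: "'v set set" where
  "tree_edges = {{v, P v} | v. v \<in> V \<and> v \<noteq> r}"

text \<open>The loops \<open>B v v\<close> of the reflexive relation do not count as edges.\<close>

definition web_edges :: "'v set set" where
  "web_edges = tree_edges \<union> {{u, v} | u v. B u v \<and> u \<noteq> v}"

lemma lev_eq_0: "v \<in> V \<Longrightarrow> lev v = 0 \<longleftrightarrow> v = r"
  using lev_parent lev_root by fastforce

lemma parent_neq: "v \<in> V \<Longrightarrow> v \<noteq> r \<Longrightarrow> P v \<noteq> v"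
  using lev_parent by fastforce

lemma parents_in: "v \<in> V \<Longrightarrow> (P ^^ n) v \<in> V"
  by (induction n) (auto intro: parent_in)

lemma tree_edge_iff:
  "{u, v} \<in> tree_edges \<longleftrightarrow>
     (u \<in> V \<and> u \<noteq> r \<and> v = P u) \<or> (v \<in> V \<and> v \<noteq> r \<and> u = P v)"
  by (auto simp: tree_edges_def doubleton_eq_iff)

lemma web_edge_iff:
  "{u, v} \<in> web_edges \<longleftrightarrow> {u, v} \<in> tree_edges \<or> (B u v \<and> u \<noteq> v)"
  by (auto simp: web_edges_def doubleton_eq_iff dest: adj_sym)

lemma tree_edge_lev:
  "{u, v} \<in> tree_edges \<Longrightarrow> lev u = Suc (lev v) \<or> lev v = Suc (lev u)"
  by (auto simp: tree_edge_iff lev_parent)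

lemma web_edge_lev: "{u, v} \<in> web_edges \<Longrightarrow> lev u \<le> lev v + 1"
  by (auto simp: web_edge_iff dest: tree_edge_lev adj_lev)

lemma web_edge_in: "{u, v} \<in> web_edges \<Longrightarrow> u \<in> V \<and> v \<in> V \<and> u \<noteq> v"
  by (metis adj_in adj_sym parent_in parent_neq tree_edge_iff web_edge_iff)

lemma tree_walk_to_root: "v \<in> V \<Longrightarrow> \<exists>p. graph_walk V tree_edges v r p"
proof (induction "lev v" arbitrary: v)
  case 0
  then have "graph_walk V tree_edges v r [v]"
    using lev_eq_0 by (auto simp: graph_walk_def)
  then show ?case by blast
next
  case (Suc n)
  then have "v \<noteq> r" using lev_root by auto
  with Suc obtain p where "graph_walk V tree_edges (P v) r p"
    using lev_parent parent_in by fastforce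
  then have "graph_walk V tree_edges v r (v # p)"
    using Suc.prems \<open>v \<noteq> r\<close> by (intro graph_walk_Cons) (auto simp: tree_edge_iff)
  then show ?case by blast
qed

text \<open>Applied both to the tree and to the web.\<close>

lemma connected_graph_between:
  assumes "tree_edges \<subseteq> E" "E \<subseteq> web_edges"
  shows "connected_graph V E"
  unfolding connected_graph_def
proof (intro conjI ballI)
  show "V \<noteq> {}" using root_in by blast
  show "E \<subseteq> {{x, y} | x y. x \<in> V \<and> y \<in> V \<and> x \<noteq> y}"
  proof
    fix e assume "e \<in> E"
    then have "e \<in> web_edges" using assms by blast
    then obtain u v where "e = {u, v}"
      by (auto simp: web_edges_def tree_edges_def)
    then show "e \<in> {{x, y} | x y. x \<in> V \<and> y \<in> V \<and> x \<noteq> y}"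
      using web_edge_in \<open>e \<in> web_edges\<close> by blast
  qed
  fix x assume x: "x \<in> V"
  have "{y. {x, y} \<in> E} \<subseteq> (\<Union>n\<in>{..lev x + 1}. {v \<in> V. lev v = n})"
  proof
    fix y assume "y \<in> {y. {x, y} \<in> E}"
    then have "{y, x} \<in> web_edges" using assms by (auto simp: insert_commute)
    then show "y \<in> (\<Union>n\<in>{..lev x + 1}. {v \<in> V. lev v = n})"
      using web_edge_in web_edge_lev by force
  qed
  then show "finite {y. {x, y} \<in> E}"
    by (rule finite_subset) (use finite_level in auto)
  fix y assume y: "y \<in> V"
  obtain p q where "graph_walk V tree_edges x r p" "graph_walk V tree_edges r y q"
    using tree_walk_to_root[OF x] tree_walk_to_root[OF y] graph_walk_rev by metis
  then have "graph_walk V tree_edges x y (p @ tl q)"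
    by (rule graph_walk_append)
  then have "graph_walk V E x y (p @ tl q)"
    using assms(1) by (auto simp: graph_walk_def elim: successively_mono)
  then show "\<exists>p. graph_walk V E x y p" by blast
qed

lemma connected_tree: "connected_graph V tree_edges"
  and connected_web: "connected_graph V web_edges"
  by (auto intro!: connected_graph_between simp: web_edges_def)

lemma level_eq: "v \<in> V \<Longrightarrow> level V tree_edges r v = lev v"
proof (rule antisym)
  assume v: "v \<in> V"
  obtain p where p: "graph_walk V tree_edges v r p"
      "graph_dist V tree_edges v r = length p - 1"
    using graph_dist_attained[OF connected_tree v root_in] .
  have "lev v \<le> lev r + (length p - 1)"
    by (rule graph_walk_Lipschitz[OF _ p(1)]) (auto dest: tree_edge_lev)
  then show "lev v \<le> level V tree_edges r v"
    by (simp add: level_def p(2) lev_root)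
  show "level V tree_edges r v \<le> lev v"
    using v
  proof (induction "lev v" arbitrary: v)
    case 0
    then have "v = r" using lev_eq_0 by simp
    then show ?case using graph_dist_self[OF root_in] by (simp add: level_def)
  next
    case (Suc n)
    then have "v \<noteq> r" using lev_root by auto
    then have "graph_dist V tree_edges v (P v) \<le> 1"
      using Suc.prems parent_in by (intro graph_dist_edge) (auto simp: tree_edge_iff)
    moreover have "graph_dist V tree_edges (P v) r \<le> n"
      using Suc.hyps(1)[of "P v"] Suc.hyps(2) lev_parent[OF Suc.prems \<open>v \<noteq> r\<close>]
        parent_in[OF Suc.prems] by (simp add: level_def)
    ultimately show ?case
      using graph_dist_triangle[OF connected_tree Suc.prems parent_in[OF Suc.prems] root_in]
        Suc.hyps(2) by (simp add: level_def)
  qed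
qed

lemma predecessor_eq:
  assumes "v \<in> V" "v \<noteq> r"
  shows "predecessor V tree_edges r v = P v"
  unfolding predecessor_def
proof (rule the_equality)
  show "{v, P v} \<in> tree_edges \<and> level V tree_edges r (P v) + 1 = level V tree_edges r v"
    using assms parent_in by (auto simp: tree_edge_iff level_eq lev_parent)
next
  fix y assume "{v, y} \<in> tree_edges \<and> level V tree_edges r y + 1 = level V tree_edges r v"
  then show "y = P v"
    using assms parent_in by (auto simp: tree_edge_iff level_eq lev_parent)
qed

text \<open>Both neighbours, on a cycle, of a vertex of maximal level would be its parent.\<close>

lemma tree_acyclic: "\<not> graph_cycle tree_edges p"
proof
  assume "graph_cycle tree_edges p"
  then have len: "3 \<le> length p" and dist: "distinct p"
    and succ: "successively (\<lambda>u v. {u, v} \<in> tree_edges) p"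
    and closed: "{last p, hd p} \<in> tree_edges"
    by (auto simp: graph_cycle_def)
  define n where "n = length p"
  have edge: "{p ! i, p ! (Suc i mod n)} \<in> tree_edges" if "i < n" for i
  proof (cases "Suc i < n")
    case True
    then show ?thesis using succ by (simp add: successively_conv_nth n_def)
  next
    case False
    then have "i = n - 1" using that by simp
    then show ?thesis using closed len
      by (simp add: n_def last_conv_nth hd_conv_nth flip: length_greater_0_conv)
  qed
  have "Max ((\<lambda>i. lev (p ! i)) ` {..<n}) \<in> (\<lambda>i. lev (p ! i)) ` {..<n}"
    using len by (intro Max_in) (auto simp: n_def lessThan_empty_iff)
  then obtain i where i: "i < n" "Max ((\<lambda>i. lev (p ! i)) ` {..<n}) = lev (p ! i)"
    by auto
  have top: "lev (p ! j) \<le> lev (p ! i)" if "j < n" for j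
    using that Max_ge[of "(\<lambda>i. lev (p ! i)) ` {..<n}"] unfolding i(2)[symmetric] by auto
  define j where "j = (if i = 0 then n - 1 else i - 1)"
  have j: "j < n" "Suc j mod n = i"
    using len i by (auto simp: j_def n_def)
  define k where "k = Suc i mod n"
  have k: "k < n" using i(1) by (simp add: k_def)
  have "j \<noteq> k"
    using len i(1) by (cases "Suc i < n") (auto simp: j_def k_def n_def not_less le_Suc_eq)
  have parent: "y = P x" if "{x, y} \<in> tree_edges" "lev y \<le> lev x" for x y
    using that tree_edge_lev[OF that(1)] by (auto simp: tree_edge_iff lev_parent)
  have "p ! k = P (p ! i)"
    using edge[OF i(1)] top[OF k] by (intro parent) (simp_all add: k_def)
  moreover have "p ! j = P (p ! i)"
    using edge[OF j(1)] top[OF j(1)] by (intro parent) (simp_all add: j(2) insert_commute)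
  ultimately show False
    using \<open>j \<noteq> k\<close> j(1) k dist by (metis n_def nth_eq_iff_index_eq)
qed

lemma spiders_web_edges: "spiders_web V web_edges"
  unfolding spiders_web_def
proof (intro conjI exI allI impI)
  show "connected_graph V web_edges" by (rule connected_web)
  show "rooted_tree V tree_edges r"
    using connected_tree tree_acyclic root_in by (auto simp: rooted_tree_def)
  show "tree_edges \<subseteq> web_edges" by (auto simp: web_edges_def)
next
  fix x y assume "{x, y} \<in> web_edges - tree_edges"
  then have "B x y" "x \<in> V" "y \<in> V"
    using web_edge_iff web_edge_in by auto
  then show "level V tree_edges r x = level V tree_edges r y"
    by (simp add: level_eq adj_lev)
next
  fix x y
  assume *: "{x, y} \<in> web_edges \<and> level V tree_edges r x = level V tree_edges r y"
  then have xy: "x \<in> V" "y \<in> V" "x \<noteq> y" using web_edge_in by blast+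
  with * have lev: "lev x = lev y" by (simp add: level_eq)
  with * have "B x y" using web_edge_iff tree_edge_lev by fastforce
  have "x \<noteq> r" "y \<noteq> r" using xy lev lev_eq_0 by metis+
  then show "predecessor V tree_edges r x = predecessor V tree_edges r y \<or>
      {predecessor V tree_edges r x, predecessor V tree_edges r y} \<in> web_edges"
    using xy \<open>B x y\<close> adj_parent by (auto simp: predecessor_eq web_edge_iff)
qed

lemma adj_parents: "B u v \<Longrightarrow> B ((P ^^ n) u) ((P ^^ n) v)"
  by (induction n) (auto intro: adj_parent)

lemma graph_dist_parents:
  "v \<in> V \<Longrightarrow> graph_dist V web_edges v ((P ^^ n) v) \<le> n"
proof (induction n)
  case 0
  then show ?case by (simp add: graph_dist_self)
next
  case (Suc n)
  let ?w = "(P ^^ n) v"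
  have w: "?w \<in> V" using Suc.prems by (rule parents_in)
  have "graph_dist V web_edges ?w (P ?w) \<le> 1"
  proof (cases "?w = r")
    case True
    then show ?thesis by (simp add: parent_root graph_dist_self root_in)
  next
    case False
    then show ?thesis using w parent_in
      by (intro graph_dist_edge) (auto simp: web_edge_iff tree_edge_iff)
  qed
  then show ?case
    using graph_dist_triangle[OF connected_web Suc.prems w parent_in[OF w]] Suc by simp
qed

lemma graph_dist_via_ancestors:
  assumes "u \<in> V" "v \<in> V" "B ((P ^^ s) u) ((P ^^ t) v)"
  shows "graph_dist V web_edges u v \<le> s + t + 1"
proof -
  let ?u = "(P ^^ s) u" and ?v = "(P ^^ t) v"
  have in_V: "?u \<in> V" "?v \<in> V" using assms by (auto intro: parents_in)
  have "graph_dist V web_edges ?u ?v \<le> 1"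
  proof (cases "?u = ?v")
    case True
    then show ?thesis by (simp add: graph_dist_self in_V)
  next
    case False
    then show ?thesis using assms in_V by (intro graph_dist_edge) (auto simp: web_edge_iff)
  qed
  moreover have "graph_dist V web_edges ?v v \<le> t"
    using graph_dist_parents[OF assms(2)] by (simp add: graph_dist_commute)
  ultimately show ?thesis
    using graph_dist_parents[OF assms(1), of s]
      graph_dist_triangle[OF connected_web assms(1) in_V(1) assms(2)]
      graph_dist_triangle[OF connected_web in_V assms(2)] by linarith
qed

text \<open>Every walk can be rearranged, without becoming longer, so that it first goes towards the root,
  then horizontally, then away from the root.  A step away from the root that precedes the rest of
  the walk either cancels against a later step towards the root or, if there is none, is moved
  to the end of the walk by applying \<open>P\<close> to the horizontal part.\<close>

lemma walk_shape:
  "graph_walk V web_edges u v p \<Longrightarrow>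
     \<exists>s t H. (B ^^ H) ((P ^^ s) u) ((P ^^ t) v) \<and> s + t + H \<le> length p - 1"
proof (induction p arbitrary: u)
  case Nil
  then show ?case by (simp add: graph_walk_def)
next
  case (Cons a q)
  show ?case
  proof (cases q)
    case Nil
    with Cons.prems have "(B ^^ 0) ((P ^^ 0) u) ((P ^^ 0) v)"
      by (auto simp: graph_walk_def)
    then show ?thesis by fastforce
  next
    case q: (Cons w q')
    with Cons.prems have edge: "{u, w} \<in> web_edges" and "graph_walk V web_edges w v q"
      by (auto simp: graph_walk_def split: if_splits)
    from Cons.IH[OF this(2)] obtain s t H
      where IH: "(B ^^ H) ((P ^^ s) w) ((P ^^ t) v)" "s + t + H \<le> length q - 1"
      by blast
    consider "B u w" | "w = P u" | "u = P w"
      using edge by (auto simp: web_edge_iff tree_edge_iff)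
    then show ?thesis
    proof cases
      case 1
      then have "(B ^^ Suc H) ((P ^^ s) u) ((P ^^ t) v)"
        using IH(1) adj_parents relpowp_Suc_I2 by metis
      then show ?thesis using IH(2) q by (intro exI[of _ s] exI[of _ t] exI[of _ "Suc H"]) simp
    next
      case 2
      then have "(B ^^ H) ((P ^^ Suc s) u) ((P ^^ t) v)"
        using IH(1) by (simp add: funpow_swap1)
      then show ?thesis using IH(2) q by (intro exI[of _ "Suc s"] exI[of _ t] exI[of _ H]) simp
    next
      case 3
      show ?thesis
      proof (cases s)
        case 0
        then have "(B ^^ H) (P w) (P ((P ^^ t) v))"
          using IH(1) by (intro relpowp_map[of B B P, OF adj_parent]) simp_all
        then have "(B ^^ H) ((P ^^ 0) u) ((P ^^ Suc t) v)"
          using 3 by simp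
        then show ?thesis using IH(2) q 0 by (intro exI[of _ 0] exI[of _ "Suc t"] exI[of _ H]) simp
      next
        case (Suc s')
        then have "(B ^^ H) ((P ^^ s') u) ((P ^^ t) v)"
          using IH(1) 3 by (simp add: funpow_swap1)
        then show ?thesis using IH(2) q Suc by (intro exI[of _ s'] exI[of _ t] exI[of _ H]) simp
      qed
    qed
  qed
qed

text \<open>If \<open>h\<close> steps towards the root bring vertices at horizontal distance \<open>2\<close> to horizontal
  distance at most \<open>1\<close>, they halve the length of every horizontal walk, up to rounding.  A walk of odd length is
  first lengthened by a loop.\<close>

lemma halve_horizontal:
  assumes halve: "\<And>x y z. B x y \<Longrightarrow> B y z \<Longrightarrow> B ((P ^^ h) x) ((P ^^ h) z)"
    and "(B ^^ n) u v" "u \<in> V"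
  shows "(B ^^ ((n + 1) div 2)) ((P ^^ h) u) ((P ^^ h) v)"
proof -
  have "(B ^^ (2 * m)) x y \<Longrightarrow> (B ^^ m) ((P ^^ h) x) ((P ^^ h) y)" for m x y
  proof (induction m arbitrary: y)
    case (Suc m)
    then obtain z w where "(B ^^ (2 * m)) x z" "B z w" "B w y"
      by (auto elim!: relcomppE)
    then show ?case using Suc.IH halve relpowp_Suc_I by metis
  qed simp
  moreover have "(B ^^ (2 * ((n + 1) div 2))) u v"
  proof (cases "even n")
    case True
    then show ?thesis using assms by auto
  next
    case False
    then have "2 * ((n + 1) div 2) = Suc n" by presburger
    then show ?thesis using assms(2,3) adj_refl relpowp_Suc_I2 by metis
  qed
  ultimately show ?thesis by blast
qed

text \<open>Moving a horizontal walk of length \<open>H\<close> towards the root by \<open>h\<close> levels costs \<open>2 * h\<close> vertical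
  steps and saves \<open>H div 2\<close> horizontal ones, which is at least as many if \<open>H \<ge> 4 * h\<close>.  So a walk of the shape above may be
  assumed to have a horizontal part of length less than \<open>4 * h\<close>.\<close>

lemma shorten_horizontal:
  assumes halve: "\<And>x y z. B x y \<Longrightarrow> B y z \<Longrightarrow> B ((P ^^ h) x) ((P ^^ h) z)"
    and h: "0 < h" and uv: "u \<in> V"
  shows "(B ^^ H) ((P ^^ s) u) ((P ^^ t) v) \<Longrightarrow> s + t + H \<le> L \<Longrightarrow>
    \<exists>s t H. (B ^^ H) ((P ^^ s) u) ((P ^^ t) v) \<and> s + t + H \<le> L \<and> H < 4 * h"
proof (induction H arbitrary: s t rule: less_induct)
  case (less H)
  show ?case
  proof (cases "H < 4 * h")
    case True
    then show ?thesis using less.prems by blast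
  next
    case False
    let ?H = "(H + 1) div 2"
    have "(B ^^ ?H) ((P ^^ (h + s)) u) ((P ^^ (h + t)) v)"
      using halve_horizontal[OF halve less.prems(1)] parents_in uv by (simp add: funpow_add)
    moreover have "?H < H" "(h + s) + (h + t) + ?H \<le> L"
      using False h less.prems(2) by linarith+
    ultimately show ?thesis using less.IH by blast
  qed
qed

end

section \<open>Hyperbolicity and growth under strict rough isometries\<close>

lemma gromov_hyperbolic_transfer:
  assumes hyp: "gromov_hyperbolic \<delta> X"
    and maps: "\<And>u. u \<in> mspace Y \<Longrightarrow> \<phi> u \<in> mspace X"
    and near: "\<And>u v. u \<in> mspace Y \<Longrightarrow> v \<in> mspace Y \<Longrightarrow>
      \<bar>mdist Y u v - mdist X (\<phi> u) (\<phi> v)\<bar> \<le> \<beta>"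
  shows "gromov_hyperbolic (\<delta> + 3 * \<beta>) Y"
  unfolding gromov_hyperbolic_def
proof (intro ballI)
  fix x y z w assume xyzw: "x \<in> mspace Y" "y \<in> mspace Y" "z \<in> mspace Y" "w \<in> mspace Y"
  have close: "\<bar>gromov_product Y w u v - gromov_product X (\<phi> w) (\<phi> u) (\<phi> v)\<bar> \<le> 3 / 2 * \<beta>"
    if "u \<in> mspace Y" "v \<in> mspace Y" for u v
    using near[OF xyzw(4) that(1)] near[OF xyzw(4) that(2)] near[OF that]
    unfolding gromov_product_def by argo
  have "gromov_product X (\<phi> w) (\<phi> x) (\<phi> z)
      \<ge> min (gromov_product X (\<phi> w) (\<phi> x) (\<phi> y)) (gromov_product X (\<phi> w) (\<phi> y) (\<phi> z)) - \<delta>"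
    using hyp maps xyzw unfolding gromov_hyperbolic_def by blast
  moreover have "0 \<le> \<beta>"
    using near[OF xyzw(1,1)] by linarith
  ultimately show "gromov_product Y w x z
      \<ge> min (gromov_product Y w x y) (gromov_product Y w y z) - (\<delta> + 3 * \<beta>)"
    using close[OF xyzw(1,2)] close[OF xyzw(2,3)] close[OF xyzw(1,3)]
    by linarith
qed

lemma mball_of_sets:
  assumes "borel_measure_on X \<mu>"
  shows "mball_of X x r \<in> sets \<mu>"
proof -
  have "openin (mtopology_of X) (mball_of X x r)"
    by (simp add: mball_of_def mtopology_of_def Metric_space.openin_mball)
  then show ?thesis
    using assms unfolding borel_measure_on_def by auto
qed

text \<open>The balls of radius \<open>1\<close> about the points of a \<open>2\<close>-separated set are disjoint, and each of them
  has measure at least \<open>c * a\<close>.\<close>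

lemma separated_card_bound:
  assumes borel: "borel_measure_on X \<mu>"
    and lower: "\<And>x r. x \<in> mspace X \<Longrightarrow> 1 \<le> r \<Longrightarrow>
      ennreal (c * a powr r) \<le> emeasure \<mu> (mball_of X x r)"
    and upper: "\<And>x r. x \<in> mspace X \<Longrightarrow> 1 \<le> r \<Longrightarrow>
      emeasure \<mu> (mball_of X x r) \<le> ennreal (C * b powr r)"
    and pos: "0 < a" "0 < b" "0 < c" "0 < C"
    and x: "x \<in> mspace X" and r: "0 \<le> r"
    and sub: "A \<subseteq> mball_of X x r"
    and sep: "\<And>y z. y \<in> A \<Longrightarrow> z \<in> A \<Longrightarrow> y \<noteq> z \<Longrightarrow> 2 \<le> mdist X y z"
  shows "finite A \<and> real (card A) \<le> C * b powr (r + 1) / (c * a)"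
proof -
  have bound: "real (card F) \<le> C * b powr (r + 1) / (c * a)" if F: "F \<subseteq> A" "finite F" for F
  proof -
    have disj: "disjoint_family_on (\<lambda>y. mball_of X y 1) F"
      unfolding disjoint_family_on_def
    proof (intro ballI impI)
      fix y z assume yz: "y \<in> F" "z \<in> F" "y \<noteq> z"
      then have "2 \<le> mdist X y z" using F sep by blast
      have "w \<notin> mball_of X z 1" if "w \<in> mball_of X y 1" for w
      proof
        assume "w \<in> mball_of X z 1"
        with that have "y \<in> mspace X" "w \<in> mspace X" "z \<in> mspace X"
            "mdist X y w < 1" "mdist X w z < 1"
          by (auto simp: mdist_commute)
        then show False
          using mdist_triangle[of y X w z] \<open>2 \<le> mdist X y z\<close> by linarith
      qed
      then show "mball_of X y 1 \<inter> mball_of X z 1 = {}" by blast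
    qed
    have "ennreal (real (card F) * (c * a)) = (\<Sum>y\<in>F. ennreal (c * a powr 1))"
      using pos by (simp add: ennreal_mult ennreal_of_nat_eq_real_of_nat)
    also have "\<dots> \<le> (\<Sum>y\<in>F. emeasure \<mu> (mball_of X y 1))"
      using F sub by (intro sum_mono lower) auto
    also have "\<dots> = emeasure \<mu> (\<Union>y\<in>F. mball_of X y 1)"
      using F disj mball_of_sets[OF borel] by (intro sum_emeasure) auto
    also have "\<dots> \<le> emeasure \<mu> (mball_of X x (r + 1))"
    proof (rule emeasure_mono)
      show "(\<Union>y\<in>F. mball_of X y 1) \<subseteq> mball_of X x (r + 1)"
      proof
        fix w assume "w \<in> (\<Union>y\<in>F. mball_of X y 1)"
        then obtain y where "y \<in> F" "w \<in> mball_of X y 1" by blast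
        moreover from this have "y \<in> mball_of X x r" using F sub by blast
        ultimately show "w \<in> mball_of X x (r + 1)"
          using mdist_triangle[of x X y w] by auto
      qed
    qed (rule mball_of_sets[OF borel])
    also have "\<dots> \<le> ennreal (C * b powr (r + 1))"
      using x r by (intro upper) auto
    finally have "real (card F) * (c * a) \<le> C * b powr (r + 1)"
      using pos by (subst (asm) ennreal_le_iff) auto
    then show ?thesis using pos by (simp add: pos_le_divide_eq)
  qed
  have "finite A \<and> card A \<le> nat \<lfloor>C * b powr (r + 1) / (c * a)\<rfloor>"
  proof (rule finite_if_finite_subsets_card_bdd)
    fix F assume "F \<subseteq> A" "finite F"
    from bound[OF this] show "card F \<le> nat \<lfloor>C * b powr (r + 1) / (c * a)\<rfloor>"
      by (simp add: le_nat_floor)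
  qed
  then show ?thesis using bound by blast
qed

text \<open>The balls of radius \<open>\<kappa> + 1\<close> about the points of a \<open>\<kappa>\<close>-dense set \<open>N\<close> that are near \<open>x\<close> cover a
  ball about \<open>x\<close>.\<close>

lemma dense_card_bound:
  assumes borel: "borel_measure_on X \<mu>"
    and lower: "\<And>x r. x \<in> mspace X \<Longrightarrow> 1 \<le> r \<Longrightarrow>
      ennreal (c * a powr r) \<le> emeasure \<mu> (mball_of X x r)"
    and upper: "\<And>x r. x \<in> mspace X \<Longrightarrow> 1 \<le> r \<Longrightarrow>
      emeasure \<mu> (mball_of X x r) \<le> ennreal (C * b powr r)"
    and pos: "0 < b" "0 < C"
    and x: "x \<in> mspace X" and r: "1 \<le> r" and \<kappa>: "0 \<le> \<kappa>"
    and sub: "N \<subseteq> mspace X"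
    and dense: "\<And>z. z \<in> mspace X \<Longrightarrow> \<exists>y\<in>N. mdist X y z \<le> \<kappa>"
    and fin: "finite (N \<inter> mball_of X x (r + \<kappa> + 1))"
  shows "c * a powr r \<le> real (card (N \<inter> mball_of X x (r + \<kappa> + 1))) * (C * b powr (\<kappa> + 1))"
proof -
  let ?F = "N \<inter> mball_of X x (r + \<kappa> + 1)"
  have "ennreal (c * a powr r) \<le> emeasure \<mu> (mball_of X x r)"
    by (rule lower[OF x r])
  also have "\<dots> \<le> emeasure \<mu> (\<Union>y\<in>?F. mball_of X y (\<kappa> + 1))"
  proof (rule emeasure_mono)
    show "mball_of X x r \<subseteq> (\<Union>y\<in>?F. mball_of X y (\<kappa> + 1))"
    proof
      fix z assume z: "z \<in> mball_of X x r"
      then obtain y where y: "y \<in> N" "mdist X y z \<le> \<kappa>" using dense by auto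
      then have "mdist X x y \<le> mdist X x z + mdist X z y"
        using z sub by (intro mdist_triangle) auto
      with y z have "y \<in> mball_of X x (r + \<kappa> + 1)"
        using sub by (auto simp: mdist_commute)
      with y z show "z \<in> (\<Union>y\<in>?F. mball_of X y (\<kappa> + 1))" by force
    qed
    show "(\<Union>y\<in>?F. mball_of X y (\<kappa> + 1)) \<in> sets \<mu>"
      using fin mball_of_sets[OF borel] by (intro sets.finite_UN) auto
  qed
  also have "\<dots> \<le> (\<Sum>y\<in>?F. emeasure \<mu> (mball_of X y (\<kappa> + 1)))"
    using fin mball_of_sets[OF borel] by (intro emeasure_subadditive_finite) auto
  also have "\<dots> \<le> (\<Sum>y\<in>?F. ennreal (C * b powr (\<kappa> + 1)))"
    using \<kappa> by (intro sum_mono upper) auto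
  also have "\<dots> = ennreal (real (card ?F) * (C * b powr (\<kappa> + 1)))"
    using pos by (simp add: ennreal_mult ennreal_of_nat_eq_real_of_nat)
  finally show ?thesis
    using pos by (subst (asm) ennreal_le_iff) auto
qed

text \<open>Exponential growth passes from a measure on \<open>X\<close> to the counting measure on \<open>Y\<close> along a map
  that changes distances by a bounded amount, has dense separated image and fibres of
  bounded size.\<close>

lemma pinched_exp_growth_transfer:
  assumes borel: "borel_measure_on X \<mu>" and growth: "pinched_exp_growth a b X \<mu>"
    and ab: "1 < a" "a \<le> b"
    and maps: "\<And>u. u \<in> mspace Y \<Longrightarrow> \<phi> u \<in> mspace X"
    and near: "\<And>u v. u \<in> mspace Y \<Longrightarrow> v \<in> mspace Y \<Longrightarrow>
      \<bar>mdist Y u v - mdist X (\<phi> u) (\<phi> v)\<bar> \<le> \<beta>"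
    and dense: "\<And>z. z \<in> mspace X \<Longrightarrow> \<exists>u\<in>mspace Y. mdist X (\<phi> u) z \<le> \<kappa>"
    and \<beta>: "0 \<le> \<beta>" and \<kappa>: "0 \<le> \<kappa>"
    and sep: "\<And>u v. u \<in> mspace Y \<Longrightarrow> v \<in> mspace Y \<Longrightarrow> \<phi> u \<noteq> \<phi> v \<Longrightarrow>
      2 \<le> mdist X (\<phi> u) (\<phi> v)"
    and h: "0 < h"
    and fibre: "\<And>x. finite {u \<in> mspace Y. \<phi> u = x} \<and> card {u \<in> mspace Y. \<phi> u = x} \<le> h"
  shows "pinched_exp_growth a b Y (count_space (mspace Y))"
proof -
  obtain c C where cC: "0 < c" "0 < C"
    and lower: "\<And>x r. x \<in> mspace X \<Longrightarrow> 1 \<le> r \<Longrightarrow>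
      ennreal (c * a powr r) \<le> emeasure \<mu> (mball_of X x r)"
    and upper: "\<And>x r. x \<in> mspace X \<Longrightarrow> 1 \<le> r \<Longrightarrow>
      emeasure \<mu> (mball_of X x r) \<le> ennreal (C * b powr r)"
    using growth unfolding pinched_exp_growth_def by blast
  have pos: "0 < a" "0 < b" using ab by auto
  note sep_bound = separated_card_bound[OF borel lower upper pos cC]
  define N where "N = \<phi> ` mspace Y"
  have N: "N \<subseteq> mspace X" using maps by (auto simp: N_def)
  have N_sep: "2 \<le> mdist X y z" if "y \<in> N" "z \<in> N" "y \<noteq> z" for y z
    using that sep by (auto simp: N_def)
  \<comment> \<open>For a radius \<open>s \<ge> r0\<close>, the image of the ball is compared with a ball of radius \<open>s - r0 + 1 \<ge> 1\<close> in \<open>X\<close>;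
    for smaller radii the lower bound comes from the centre of the ball alone.\<close>
  define r0 where "r0 = \<kappa> + \<beta> + 2"
  define c1 where "c1 = min (c * a powr (1 - r0) / (C * b powr (\<kappa> + 1))) (a powr (- r0))"
  define C1 where "C1 = real h * (C * b powr (\<beta> + 1) / (c * a))"
  have pos1: "0 < c1" "0 < C1"
    using cC pos h by (auto simp: c1_def C1_def)
  have main: "finite S \<and> c1 * a powr s \<le> real (card S) \<and> real (card S) \<le> C1 * b powr s"
    if u: "u \<in> mspace Y" and s: "1 \<le> s" and S: "S = mball_of Y u s" for u s S
  proof -
    have img: "\<phi> ` S \<subseteq> mball_of X (\<phi> u) (s + \<beta>)"
    proof
      fix z assume "z \<in> \<phi> ` S"
      then obtain v where "v \<in> mspace Y" "mdist Y u v < s" "z = \<phi> v" by (auto simp: S)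
      then show "z \<in> mball_of X (\<phi> u) (s + \<beta>)"
        using near[OF u, of v] maps u by auto
    qed
    have fimg: "finite (\<phi> ` S) \<and> real (card (\<phi> ` S)) \<le> C * b powr (s + \<beta> + 1) / (c * a)"
      using img maps[OF u] s \<beta> sep
      by (intro sep_bound) (auto simp: S)
    have S_eq: "S = (\<Union>x\<in>\<phi> ` S. {v \<in> S. \<phi> v = x})" by auto
    have fib: "finite {v \<in> S. \<phi> v = x} \<and> card {v \<in> S. \<phi> v = x} \<le> h" for x
    proof -
      have "{v \<in> S. \<phi> v = x} \<subseteq> {v \<in> mspace Y. \<phi> v = x}" by (auto simp: S)
      then show ?thesis using fibre[of x] by (meson card_mono finite_subset le_trans)
    qed
    have fin: "finite S"
      by (subst S_eq, rule finite_UN_I) (use fimg fib in blast)+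
    have "card S \<le> (\<Sum>x\<in>\<phi> ` S. card {v \<in> S. \<phi> v = x})"
      by (subst S_eq, rule card_UN_le) (use fimg in auto)
    also have "\<dots> \<le> card (\<phi> ` S) * h"
      using sum_bounded_above[of "\<phi> ` S" "\<lambda>x. card {v \<in> S. \<phi> v = x}" h] fib by simp
    finally have "real (card S) \<le> real (card (\<phi> ` S)) * real h"
      by (simp flip: of_nat_mult)
    also have "\<dots> \<le> (C * b powr (s + \<beta> + 1) / (c * a)) * real h"
      using fimg by (intro mult_right_mono) auto
    also have "\<dots> = C1 * b powr s"
      by (simp add: C1_def powr_add field_simps)
    finally have up: "real (card S) \<le> C1 * b powr s" .
    have low: "c1 * a powr s \<le> real (card S)"
    proof (cases "s < r0")
      case True
      have "c1 * a powr s \<le> a powr (- r0) * a powr s"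
        by (intro mult_right_mono) (auto simp: c1_def)
      also have "\<dots> = a powr (s - r0)" by (simp flip: powr_add)
      also have "\<dots> \<le> a powr 0" using True ab by (intro powr_mono) auto
      also have "\<dots> \<le> real (card S)"
      proof -
        have "mdist Y u u = 0" using u by simp
        then have "u \<in> S" using u s by (simp add: S del: mdist_zero)
        then have "0 < card S" using fin card_gt_0_iff by blast
        then show ?thesis using pos by simp
      qed
      finally show ?thesis .
    next
      case False
      define t where "t = s - r0 + 1"
      have t: "1 \<le> t" using False by (simp add: t_def)
      let ?F = "N \<inter> mball_of X (\<phi> u) (t + \<kappa> + 1)"
      have F: "?F \<subseteq> \<phi> ` S"
      proof
        fix z assume "z \<in> ?F"
        then obtain v where "v \<in> mspace Y" "z = \<phi> v" "mdist X (\<phi> u) (\<phi> v) < t + \<kappa> + 1"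
          by (auto simp: N_def)
        then show "z \<in> \<phi> ` S"
          using near[OF u, of v] u by (auto simp: S t_def r0_def)
      qed
      have "c * a powr t \<le> real (card ?F) * (C * b powr (\<kappa> + 1))"
      proof (rule dense_card_bound[OF borel lower upper pos(2) cC(2) maps[OF u] t \<kappa> N])
        show "\<exists>y\<in>N. mdist X y z \<le> \<kappa>" if "z \<in> mspace X" for z
          using dense[OF that] by (auto simp: N_def)
        show "finite ?F" using F fimg finite_subset by blast
      qed
      also have "\<dots> \<le> real (card S) * (C * b powr (\<kappa> + 1))"
      proof -
        have "card ?F \<le> card S"
          using card_mono[OF _ F] fimg card_image_le[OF fin, of \<phi>] by linarith
        then show ?thesis using cC by (intro mult_right_mono) auto
      qed
      finally have "c * a powr t / (C * b powr (\<kappa> + 1)) \<le> real (card S)"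
        using cC pos by (simp add: pos_divide_le_eq)
      moreover have "c1 * a powr s \<le> c * a powr (1 - r0) / (C * b powr (\<kappa> + 1)) * a powr s"
        by (intro mult_right_mono) (auto simp: c1_def)
      moreover have "c * a powr (1 - r0) / (C * b powr (\<kappa> + 1)) * a powr s
          = c * a powr t / (C * b powr (\<kappa> + 1))"
      proof -
        have "a powr t = a powr (1 - r0) * a powr s"
          by (simp add: t_def algebra_simps flip: powr_add)
        then show ?thesis by simp
      qed
      ultimately show ?thesis by linarith
    qed
    show ?thesis using fin up low by blast
  qed
  show ?thesis
    unfolding pinched_exp_growth_def
  proof (intro exI conjI ballI allI impI)
    fix u s assume us: "u \<in> mspace Y" "(1::real) \<le> s"
    let ?S = "mball_of Y u s"
    have m: "finite ?S" "c1 * a powr s \<le> real (card ?S)" "real (card ?S) \<le> C1 * b powr s"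
      using main[OF us refl] by auto
    have "?S \<subseteq> mspace Y" by auto
    then have "emeasure (count_space (mspace Y)) ?S = ennreal (real (card ?S))"
      using m(1) by (simp add: emeasure_count_space_finite ennreal_of_nat_eq_real_of_nat)
    then show "ennreal (c1 * a powr s) \<le> emeasure (count_space (mspace Y)) ?S"
        "emeasure (count_space (mspace Y)) ?S \<le> ennreal (C1 * b powr s)"
      using m by (auto intro: ennreal_leI)
  qed (use pos1 in auto)
qed

section \<open>Webs that follow a metric space\<close>

text \<open>The conditions on a map \<open>\<phi>\<close> from a web to a metric space that make it a strict rough isometry
  (\<open>climb\<close> to \<open>dense\<close>) and let it transfer exponential growth (\<open>separated\<close> and the bound on the
  fibres).  The two conditions that give distances in the web are \<open>adj_halve\<close>, by which
  horizontal walks contract towards the root, and \<open>meet\<close>, by which two vertices have equal or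
  adjacent ancestors about as far away as the distance in \<open>X\<close> predicts.\<close>

locale coarse_web = radial_web V r lev P B
  for V :: "'v set" and r lev P B +
  fixes X :: "'a metric" and \<phi> :: "'v \<Rightarrow> 'a" and h :: nat and R \<kappa> :: real
  assumes h_pos: "0 < h"
    and maps_in: "v \<in> V \<Longrightarrow> \<phi> v \<in> mspace X"
    and climb: "v \<in> V \<Longrightarrow> mdist X (\<phi> v) (\<phi> ((P ^^ s) v)) \<le> real s + \<kappa>"
    and adj_near: "B u v \<Longrightarrow> mdist X (\<phi> u) (\<phi> v) \<le> R"
    and adj_halve: "B u v \<Longrightarrow> B v w \<Longrightarrow> B ((P ^^ h) u) ((P ^^ h) w)"
    and meet: "u \<in> V \<Longrightarrow> v \<in> V \<Longrightarrow>
      \<exists>s t. B ((P ^^ s) u) ((P ^^ t) v) \<and> real (s + t) \<le> mdist X (\<phi> u) (\<phi> v) + \<kappa>"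
    and dense: "z \<in> mspace X \<Longrightarrow> \<exists>v\<in>V. mdist X (\<phi> v) z \<le> \<kappa>"
    and separated: "u \<in> V \<Longrightarrow> v \<in> V \<Longrightarrow> \<phi> u \<noteq> \<phi> v \<Longrightarrow> 2 \<le> mdist X (\<phi> u) (\<phi> v)"
    and finite_fibre: "finite {v \<in> V. \<phi> v = x}"
    and card_fibre: "card {v \<in> V. \<phi> v = x} \<le> h"
begin

lemma R_nonneg: "0 \<le> R"
  by (rule order_trans[OF mdist_nonneg adj_near[OF adj_refl[OF root_in]]])

lemma \<kappa>_nonneg: "0 \<le> \<kappa>"
  using order_trans[OF mdist_nonneg climb[OF root_in, of 0]] by simp

lemma relpow_adj_near:
  "(B ^^ n) u v \<Longrightarrow> u \<in> V \<Longrightarrow> v \<in> V \<and> mdist X (\<phi> u) (\<phi> v) \<le> real n * R"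
proof (induction n arbitrary: v)
  case 0
  then have "mdist X (\<phi> u) (\<phi> u) = 0" using maps_in by simp
  with 0 show ?case by simp
next
  case (Suc n)
  then obtain w where w: "(B ^^ n) u w" "B w v" by (meson relpowp_Suc_E)
  from Suc.IH[OF w(1) Suc.prems(2)]
  have "w \<in> V" "mdist X (\<phi> u) (\<phi> w) \<le> real n * R" by blast+
  moreover have "v \<in> V" using adj_in[OF adj_sym[OF w(2)]] .
  moreover have "mdist X (\<phi> u) (\<phi> v) \<le> mdist X (\<phi> u) (\<phi> w) + mdist X (\<phi> w) (\<phi> v)"
    by (intro mdist_triangle maps_in Suc.prems(2) calculation)
  ultimately show ?case using adj_near[OF w(2)] by (simp add: algebra_simps)
qed

text \<open>Up to constants, a shortest walk consists of two vertical parts, along which \<open>\<phi>\<close> increases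
  distances by at most \<open>\<kappa>\<close>, and a horizontal part of bounded length.\<close>

lemma dist_image_le:
  assumes "u \<in> V" "v \<in> V"
  shows "mdist X (\<phi> u) (\<phi> v) \<le> real (graph_dist V web_edges u v) + (2 * \<kappa> + 4 * real h * R)"
proof -
  obtain p where p: "graph_walk V web_edges u v p" "graph_dist V web_edges u v = length p - 1"
    using graph_dist_attained[OF connected_web assms] .
  obtain s' t' H' where "(B ^^ H') ((P ^^ s') u) ((P ^^ t') v)"
      "s' + t' + H' \<le> length p - 1"
    using walk_shape[OF p(1)] by blast
  then have "\<exists>s t H. (B ^^ H) ((P ^^ s) u) ((P ^^ t) v) \<and> s + t + H \<le> length p - 1 \<and> H < 4 * h"
    by (intro shorten_horizontal[OF _ h_pos assms(1)]) (auto intro: adj_halve)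
  then obtain s t H where sth: "(B ^^ H) ((P ^^ s) u) ((P ^^ t) v)"
      "s + t + H \<le> length p - 1" "H < 4 * h"
    by blast
  let ?u = "(P ^^ s) u" and ?v = "(P ^^ t) v"
  have in_V: "?u \<in> V" "?v \<in> V" using assms by (auto intro: parents_in)
  have "mdist X (\<phi> ?u) (\<phi> ?v) \<le> real H * R"
    using relpow_adj_near[OF sth(1) in_V(1)] by blast
  also have "\<dots> \<le> 4 * real h * R"
    using sth(3) R_nonneg by (intro mult_right_mono) auto
  finally have "mdist X (\<phi> ?u) (\<phi> ?v) \<le> 4 * real h * R" .
  moreover have "mdist X (\<phi> u) (\<phi> v) \<le> mdist X (\<phi> u) (\<phi> ?u) + mdist X (\<phi> ?u) (\<phi> v)"
      "mdist X (\<phi> ?u) (\<phi> v) \<le> mdist X (\<phi> ?u) (\<phi> ?v) + mdist X (\<phi> ?v) (\<phi> v)"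
    using assms in_V maps_in by (auto intro!: mdist_triangle)
  moreover have "mdist X (\<phi> u) (\<phi> ?u) \<le> real s + \<kappa>" "mdist X (\<phi> ?v) (\<phi> v) \<le> real t + \<kappa>"
    using climb assms by (simp_all add: mdist_commute)
  moreover have "real s + real t \<le> real (graph_dist V web_edges u v)"
    using sth(2) p(2) by linarith
  ultimately show ?thesis by linarith
qed

lemma dist_image_ge:
  assumes "u \<in> V" "v \<in> V"
  shows "real (graph_dist V web_edges u v) \<le> mdist X (\<phi> u) (\<phi> v) + \<kappa> + 1"
proof -
  obtain s t where "B ((P ^^ s) u) ((P ^^ t) v)"
      "real (s + t) \<le> mdist X (\<phi> u) (\<phi> v) + \<kappa>"
    using meet[OF assms] by blast
  with graph_dist_via_ancestors[OF assms this(1)] show ?thesis by linarith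
qed

text \<open>The additive constant of the strict rough isometry.\<close>

definition distortion :: real where
  "distortion = 2 * \<kappa> + 4 * real h * R + 1"

lemma distortion_nonneg: "0 \<le> distortion"
  using R_nonneg \<kappa>_nonneg by (simp add: distortion_def)

lemma dist_image_close:
  assumes "u \<in> V" "v \<in> V"
  shows "\<bar>mdist (graph_metric V web_edges) u v - mdist X (\<phi> u) (\<phi> v)\<bar> \<le> distortion"
proof -
  have "0 \<le> 4 * real h * R" using R_nonneg by simp
  then show ?thesis
    using dist_image_le[OF assms] dist_image_ge[OF assms] \<kappa>_nonneg
    unfolding mdist_graph_metric[OF connected_web] distortion_def by linarith
qed

lemma strict_rough_isometry_web: "strict_rough_isometry (graph_metric V web_edges) X \<phi>"
  unfolding strict_rough_isometry_def mspace_graph_metric[OF connected_web]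
proof (intro conjI exI[of _ distortion] ballI distortion_nonneg)
  show "\<phi> ` V \<subseteq> mspace X" using maps_in by blast
  have "(SUP y'\<in>mspace X. INF x\<in>V. ereal (mdist X (\<phi> x) y')) \<le> ereal \<kappa>"
  proof (rule SUP_least)
    fix z assume "z \<in> mspace X"
    then obtain v where "v \<in> V" "mdist X (\<phi> v) z \<le> \<kappa>" using dense by blast
    then show "(INF x\<in>V. ereal (mdist X (\<phi> x) z)) \<le> ereal \<kappa>"
      by (intro INF_lower2) auto
  qed
  then show "(SUP y'\<in>mspace X. INF x\<in>V. ereal (mdist X (\<phi> x) y')) < \<infinity>"
    by (rule le_less_trans) simp
next
  fix x y assume "x \<in> V" "y \<in> V"
  from dist_image_close[OF this]
  show "mdist (graph_metric V web_edges) x y - distortion \<le> mdist X (\<phi> x) (\<phi> y)"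
    and "mdist X (\<phi> x) (\<phi> y) \<le> mdist (graph_metric V web_edges) x y + distortion"
    by linarith+
qed

lemma class_Upsilon_web:
  assumes "gromov_hyperbolic \<delta> X" "borel_measure_on X \<mu>" "pinched_exp_growth a b X \<mu>"
    and "1 < a" "a \<le> b"
  shows "class_Upsilon (\<delta> + 3 * distortion) a b V web_edges"
  unfolding class_Upsilon_def
proof (intro conjI)
  note mspace = mspace_graph_metric[OF connected_web]
  show "spiders_web V web_edges" by (rule spiders_web_edges)
  show "gromov_hyperbolic (\<delta> + 3 * distortion) (graph_metric V web_edges)"
    by (rule gromov_hyperbolic_transfer[OF assms(1), of _ \<phi>])
      (use maps_in dist_image_close in \<open>auto simp: mspace\<close>)
  have "pinched_exp_growth a b (graph_metric V web_edges)
      (count_space (mspace (graph_metric V web_edges)))"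
    by (rule pinched_exp_growth_transfer[OF assms(2-5), of _ \<phi> distortion \<kappa> h])
      (use maps_in dist_image_close dense separated h_pos finite_fibre card_fibre
          distortion_nonneg \<kappa>_nonneg in \<open>auto simp: mspace\<close>)
  then show "pinched_exp_growth a b (graph_metric V web_edges) (count_space V)"
    by (simp add: mspace)
qed

end

text \<open>Webs may be renamed along an injection, in particular to make the vertices natural numbers.\<close>

lemma coarse_web_transfer:
  assumes "coarse_web V r lev P B X \<phi> h R \<kappa>" and f: "inj_on f V"
  defines "g \<equiv> inv_into V f"
  shows "coarse_web (f ` V) (f r) (lev \<circ> g) (f \<circ> P \<circ> g)
    (\<lambda>u v. u \<in> f ` V \<and> v \<in> f ` V \<and> B (g u) (g v)) X (\<phi> \<circ> g) h R \<kappa>"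
proof -
  interpret coarse_web V r lev P B X \<phi> h R \<kappa> by fact
  have gf [simp]: "g (f v) = v" if "v \<in> V" for v
    using f that by (simp add: g_def)
  have iter: "((f \<circ> P \<circ> g) ^^ s) (f v) = f ((P ^^ s) v)" if "v \<in> V" for v s
    using that by (induction s) (auto simp: parents_in)
  show ?thesis
  proof
    show "f r \<in> f ` V" using root_in by blast
    show "(f \<circ> P \<circ> g) (f r) = f r" using root_in parent_root by simp
    show "(lev \<circ> g) (f r) = 0" using root_in lev_root by simp
    show "(lev \<circ> g) v = Suc ((lev \<circ> g) ((f \<circ> P \<circ> g) v))" if "v \<in> f ` V" "v \<noteq> f r" for v
    proof -
      obtain v' where v': "v' \<in> V" "v = f v'" using \<open>v \<in> f ` V\<close> by blast
      with that(2) have "v' \<noteq> r" by blast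
      then show ?thesis using v' lev_parent[of v'] parent_in[of v'] by simp
    qed
    show "finite {v \<in> f ` V. (lev \<circ> g) v = n}" for n
    proof -
      have "{v \<in> f ` V. (lev \<circ> g) v = n} = f ` {v \<in> V. lev v = n}" by auto
      then show ?thesis using finite_level by simp
    qed
    fix x
    have fib: "{v \<in> f ` V. (\<phi> \<circ> g) v = x} = f ` {v \<in> V. \<phi> v = x}" by auto
    show "finite {v \<in> f ` V. (\<phi> \<circ> g) v = x}"
      unfolding fib using finite_fibre by simp
    show "card {v \<in> f ` V. (\<phi> \<circ> g) v = x} \<le> h"
      unfolding fib using card_image_le[OF finite_fibre] card_fibre le_trans by blast
  next
    fix u v assume "u \<in> f ` V" "v \<in> f ` V"
    then obtain u' v' where uv: "u' \<in> V" "v' \<in> V" "u = f u'" "v = f v'" by blast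
    obtain s t where "B ((P ^^ s) u') ((P ^^ t) v')"
        "real (s + t) \<le> mdist X (\<phi> u') (\<phi> v') + \<kappa>"
      using meet[OF uv(1,2)] by blast
    then show "\<exists>s t. (((f \<circ> P \<circ> g) ^^ s) u \<in> f ` V \<and> ((f \<circ> P \<circ> g) ^^ t) v \<in> f ` V
        \<and> B (g (((f \<circ> P \<circ> g) ^^ s) u)) (g (((f \<circ> P \<circ> g) ^^ t) v)))
        \<and> real (s + t) \<le> mdist X ((\<phi> \<circ> g) u) ((\<phi> \<circ> g) v) + \<kappa>"
      using uv parents_in by (intro exI[of _ s] exI[of _ t]) (auto simp: iter)
  next
    fix v assume "v \<in> f ` V"
    then obtain v' where v: "v' \<in> V" "v = f v'" by blast
    then show "(f \<circ> P \<circ> g) v \<in> f ` V" "(\<phi> \<circ> g) v \<in> mspace X"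
        "v \<in> f ` V \<and> v \<in> f ` V \<and> B (g v) (g v)"
      using parent_in maps_in adj_refl by auto
    show "mdist X ((\<phi> \<circ> g) v) ((\<phi> \<circ> g) (((f \<circ> P \<circ> g) ^^ s) v)) \<le> real s + \<kappa>" for s
      using v climb by (simp add: iter parents_in)
    show "2 \<le> mdist X ((\<phi> \<circ> g) u) ((\<phi> \<circ> g) v)"
      if "u \<in> f ` V" "(\<phi> \<circ> g) u \<noteq> (\<phi> \<circ> g) v" for u
      using that v separated by auto
  next
    show "\<exists>v\<in>f ` V. mdist X ((\<phi> \<circ> g) v) z \<le> \<kappa>" if "z \<in> mspace X" for z
    proof -
      obtain v where "v \<in> V" "mdist X (\<phi> v) z \<le> \<kappa>" using dense \<open>z \<in> mspace X\<close> by blast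
      then show ?thesis by (intro bexI[of _ "f v"]) auto
    qed
  next
    fix u v assume "u \<in> f ` V \<and> v \<in> f ` V \<and> B (g u) (g v)"
    then obtain u' v' where uv: "u' \<in> V" "v' \<in> V" "u = f u'" "v = f v'" "B u' v'" by auto
    then show "u \<in> f ` V" "v \<in> f ` V \<and> u \<in> f ` V \<and> B (g v) (g u)"
        "(lev \<circ> g) u = (lev \<circ> g) v" "mdist X ((\<phi> \<circ> g) u) ((\<phi> \<circ> g) v) \<le> R"
      using adj_sym adj_lev adj_near by auto
    show "(f \<circ> P \<circ> g) u \<in> f ` V \<and> (f \<circ> P \<circ> g) v \<in> f ` V
        \<and> B (g ((f \<circ> P \<circ> g) u)) (g ((f \<circ> P \<circ> g) v))"
      using uv parent_in adj_parent by simp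
    fix t assume "v \<in> f ` V \<and> t \<in> f ` V \<and> B (g v) (g t)"
    then obtain t' where t: "t' \<in> V" "t = f t'" "B v' t'" using uv by auto
    show "((f \<circ> P \<circ> g) ^^ h) u \<in> f ` V \<and> ((f \<circ> P \<circ> g) ^^ h) t \<in> f ` V
        \<and> B (g (((f \<circ> P \<circ> g) ^^ h) u)) (g (((f \<circ> P \<circ> g) ^^ h) t))"
      using uv t adj_halve parents_in by (simp add: iter)
  qed (rule h_pos)
qed

section \<open>Radial nets\<close>

lemma curve_length_ge_two_steps:
  assumes "0 \<le> s" "s \<le> 1"
  shows "ereal (mdist X (g 0) (g s) + mdist X (g s) (g 1)) \<le> curve_length X g"
proof -
  define t :: "nat \<Rightarrow> real" where "t = (\<lambda>i. if i = 0 then 0 else if i = 1 then s else 1)"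
  have "(\<Sum>i<2. mdist X (g (t i)) (g (t (Suc i)))) = mdist X (g 0) (g s) + mdist X (g s) (g 1)"
    by (simp add: t_def numeral_2_eq_2)
  moreover have "\<forall>i\<le>2. t i \<in> {0..1}" "\<forall>i<2. t i \<le> t (Suc i)"
    using assms by (auto simp: t_def)
  ultimately show ?thesis
    unfolding curve_length_def by (intro Sup_upper CollectI exI[of _ 2] exI[of _ t]) auto
qed

text \<open>The point is found on a shortest path by the intermediate value theorem.\<close>

lemma strictly_intrinsic_point_between:
  assumes X: "strictly_intrinsic X" and xy: "x \<in> mspace X" "y \<in> mspace X"
    and l: "0 \<le> l" "l \<le> mdist X x y"
  obtains z where "z \<in> mspace X" "mdist X x z = l" "mdist X z y = mdist X x y - l"
proof -
  obtain g where g: "curve_between X x y g" "curve_length X g = ereal (mdist X x y)"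
    using X xy unfolding strictly_intrinsic_def by blast
  have cont: "continuous_map (top_of_set {0..1}) (mtopology_of X) g"
    and ends: "g 0 = x" "g 1 = y"
    using g(1) by (auto simp: curve_between_def pathin_def)
  have in_X: "g s \<in> mspace X" if "s \<in> {0..1}" for s
    using continuous_map_image_subset_topspace[OF cont] that by auto
  have "continuous_map (top_of_set {0..1}) euclideanreal (\<lambda>s. mdist X x (g s))"
    using xy cont by (intro continuous_map_mdist) auto
  then have "continuous_on {0..1} (\<lambda>s. mdist X x (g s))"
    by (simp add: continuous_map_iff_continuous)
  moreover have "mdist X x (g 0) = 0" using xy ends by simp
  ultimately obtain s where s: "0 \<le> s" "s \<le> 1" "mdist X x (g s) = l"
    using IVT'[of "\<lambda>s. mdist X x (g s)" 0 l 1] l ends by auto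
  have "mdist X x (g s) + mdist X (g s) y \<le> mdist X x y"
    using curve_length_ge_two_steps[OF s(1,2), of X g] g(2) ends by simp
  moreover have "mdist X x y \<le> mdist X x (g s) + mdist X (g s) y"
    using xy in_X s by (intro mdist_triangle) auto
  ultimately show thesis using that[of "g s"] in_X s by auto
qed

lemma maximal_separated_subset:
  obtains N where "N \<subseteq> A" "\<And>x y. x \<in> N \<Longrightarrow> y \<in> N \<Longrightarrow> x \<noteq> y \<Longrightarrow> e \<le> mdist X x y"
    "\<And>x. x \<in> A \<Longrightarrow> \<exists>y\<in>N. x = y \<or> mdist X x y < e"
proof -
  define F where "F = {N. N \<subseteq> A \<and> (\<forall>x\<in>N. \<forall>y\<in>N. x \<noteq> y \<longrightarrow> e \<le> mdist X x y)}"
  have "\<exists>N\<in>F. \<forall>N'\<in>F. N \<subseteq> N' \<longrightarrow> N' = N"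
  proof (rule subset_Zorn')
    fix C assume "subset.chain F C"
    then have C: "C \<subseteq> F" "\<And>N N'. N \<in> C \<Longrightarrow> N' \<in> C \<Longrightarrow> N \<subseteq> N' \<or> N' \<subseteq> N"
      by (auto simp: subset_chain_def)
    show "\<Union> C \<in> F"
      unfolding F_def
    proof (intro CollectI conjI ballI impI)
      show "\<Union> C \<subseteq> A" using C(1) by (auto simp: F_def)
      fix x y assume "x \<in> \<Union> C" "y \<in> \<Union> C" "x \<noteq> y"
      then obtain N where "N \<in> C" "x \<in> N" "y \<in> N" using C(2) by blast
      with C(1) \<open>x \<noteq> y\<close> show "e \<le> mdist X x y" by (auto simp: F_def)
    qed
  qed
  then obtain N where N: "N \<in> F" "\<And>N'. N' \<in> F \<Longrightarrow> N \<subseteq> N' \<Longrightarrow> N' = N" by blast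
  have "\<exists>y\<in>N. x = y \<or> mdist X x y < e" if x: "x \<in> A" for x
  proof (rule ccontr)
    assume far: "\<not> ?thesis"
    then have "insert x N \<in> F"
      using N(1) x by (auto simp: F_def mdist_commute not_less)
    then have "x \<in> N" using N(2)[of "insert x N"] by blast
    with far show False by blast
  qed
  with N(1) show thesis using that[of N] by (auto simp: F_def)
qed

text \<open>A net in the union of the spheres about \<open>w\<close> whose radius is a multiple of \<open>h\<close>: a point \<open>x\<close> of the
  net has distance \<open>k x * h\<close> from \<open>w\<close>, and \<open>p x\<close> is a point of the net on the preceding
  sphere at distance at most \<open>h + 2\<close> from \<open>x\<close>, hence close to any geodesic from \<open>x\<close> to \<open>w\<close>; the point
  \<open>w\<close> is its own parent.  The step \<open>h\<close> is large compared with \<open>\<delta>\<close>; this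
  makes the errors of iterated passages from \<open>x\<close> to \<open>p x\<close> stay bounded and makes horizontal
  distances contract.\<close>

locale radial_net =
  fixes X :: "'a metric" and \<delta> :: real and w :: 'a and h :: nat
    and N :: "'a set" and k :: "'a \<Rightarrow> nat" and p :: "'a \<Rightarrow> 'a"
  assumes hyperbolic: "gromov_hyperbolic \<delta> X"
    and \<delta>_nonneg: "0 \<le> \<delta>"
    and base_in: "w \<in> N"
    and net_in: "N \<subseteq> mspace X"
    and h_large: "2 + 6 * \<delta> \<le> real h"
    and dist_base: "x \<in> N \<Longrightarrow> mdist X w x = real (k x) * real h"
    and net_separated: "x \<in> N \<Longrightarrow> y \<in> N \<Longrightarrow> x \<noteq> y \<Longrightarrow> 2 \<le> mdist X x y"
    and net_dense: "z \<in> mspace X \<Longrightarrow> \<exists>y\<in>N. mdist X y z \<le> real h + 2"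
    and net_finite: "finite {x \<in> N. k x = n}"
    and p_in: "x \<in> N \<Longrightarrow> p x \<in> N"
    and p_base: "p w = w"
    and k_p: "x \<in> N \<Longrightarrow> k (p x) = k x - 1"
    and dist_p: "x \<in> N \<Longrightarrow> mdist X x (p x) \<le> real h + 2"
begin

abbreviation gp :: "'a \<Rightarrow> 'a \<Rightarrow> real" where
  "gp x y \<equiv> gromov_product X w x y"

lemma in_X: "x \<in> N \<Longrightarrow> x \<in> mspace X"
  using net_in by blast

lemma h_pos: "0 < h"
  using h_large \<delta>_nonneg by (cases h) auto

lemma gp_commute: "gp x y = gp y x"
  by (simp add: gromov_product_def mdist_commute)

lemma gp_hyperbolic: "x \<in> N \<Longrightarrow> y \<in> N \<Longrightarrow> z \<in> N \<Longrightarrow> min (gp x y) (gp y z) - \<delta> \<le> gp x z"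
  using hyperbolic in_X base_in unfolding gromov_hyperbolic_def by blast

lemma dist_eq_gp:
  "x \<in> N \<Longrightarrow> y \<in> N \<Longrightarrow> mdist X x y = real (k x) * real h + real (k y) * real h - 2 * gp x y"
  by (simp add: gromov_product_def dist_base field_simps)

lemma k_base: "k w = 0"
proof -
  have "mdist X w w = 0" using in_X[OF base_in] by simp
  with dist_base[OF base_in] show ?thesis using h_pos by simp
qed

lemma k_eq_0: "x \<in> N \<Longrightarrow> k x = 0 \<longleftrightarrow> x = w"
  using dist_base[of x] in_X[of x] in_X[OF base_in] k_base by auto

lemma p_iter_in: "x \<in> N \<Longrightarrow> (p ^^ n) x \<in> N"
  by (induction n) (auto intro: p_in)

lemma k_p_iter: "x \<in> N \<Longrightarrow> k ((p ^^ n) x) = k x - n"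
  by (induction n) (auto simp: k_p p_iter_in)

lemma gp_p:
  assumes "x \<in> N" "0 < k x"
  shows "(real (k x) - 1) * real h - 1 \<le> gp (p x) x"
  using dist_p[OF assms(1)] dist_eq_gp[OF p_in[OF assms(1)] assms(1)] k_p[OF assms(1)] assms(2)
  by (simp add: mdist_commute algebra_simps of_nat_diff)

text \<open>The iterates of \<open>p\<close> stay near a geodesic from \<open>x\<close> to \<open>w\<close>.  The error does not accumulate: with
  \<open>c\<close> the radius of the sphere of \<open>(p ^^ Suc n) x\<close>, the Gromov product of \<open>(p ^^ n) x\<close> and \<open>x\<close> is at
  least \<open>c + h - (1 + \<delta>) \<ge> c\<close> by induction, so in the hyperbolicity inequality only the error of the
  last step counts.\<close>

lemma gp_p_iter:
  assumes x: "x \<in> N"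
  shows "n \<le> k x \<Longrightarrow> (real (k x) - real n) * real h - (1 + \<delta>) \<le> gp ((p ^^ n) x) x"
proof (induction n)
  case 0
  have "mdist X x x = 0" using in_X[OF x] by simp
  then have "real (k x) * real h = gp x x" using dist_eq_gp[OF x x] by linarith
  then show ?case using \<delta>_nonneg by simp
next
  case (Suc n)
  let ?y = "(p ^^ n) x"
  have y: "?y \<in> N" "k ?y = k x - n" using x by (simp_all add: p_iter_in k_p_iter)
  let ?a = "(real (k x) - real (Suc n)) * real h"
  have "?a - 1 \<le> gp (p ?y) ?y"
    using gp_p[OF y(1)] y(2) Suc.prems by (simp add: algebra_simps of_nat_diff)
  moreover have "?a \<le> gp ?y x"
    using Suc.IH Suc.prems h_large \<delta>_nonneg by (simp add: algebra_simps)
  moreover have "min (gp (p ?y) ?y) (gp ?y x) - \<delta> \<le> gp (p ?y) x"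
    using y x p_in by (intro gp_hyperbolic) auto
  ultimately show ?case by simp
qed

lemma dist_p_iter:
  assumes x: "x \<in> N" and n: "n \<le> k x"
  shows "mdist X x ((p ^^ n) x) \<le> real n * real h + 2 + 2 * \<delta>"
  using gp_p_iter[OF assms] dist_eq_gp[OF p_iter_in[OF x, of n] x] k_p_iter[OF x, of n] n
  by (simp add: mdist_commute algebra_simps of_nat_diff)

text \<open>Below the level of the Gromov product of two points, their ancestors are close together.\<close>

lemma ancestors_near:
  assumes x: "x \<in> N" and y: "y \<in> N" and i: "i \<le> k x" "i \<le> k y"
    and gp: "real i * real h \<le> gp x y"
  shows "mdist X ((p ^^ (k x - i)) x) ((p ^^ (k y - i)) y) \<le> 2 + 6 * \<delta>"
proof -
  let ?x = "(p ^^ (k x - i)) x" and ?y = "(p ^^ (k y - i)) y"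
  have xy: "?x \<in> N" "?y \<in> N" "k ?x = i" "k ?y = i"
    using x y i by (simp_all add: p_iter_in k_p_iter)
  have "real i * real h - (1 + \<delta>) \<le> gp ?x x"
    using gp_p_iter[OF x, of "k x - i"] i by (simp add: of_nat_diff)
  moreover have "real i * real h - (1 + \<delta>) \<le> gp y ?y"
    using gp_p_iter[OF y, of "k y - i"] i by (simp add: of_nat_diff gp_commute)
  moreover have "min (gp ?x x) (gp x y) - \<delta> \<le> gp ?x y" "min (gp ?x y) (gp y ?y) - \<delta> \<le> gp ?x ?y"
    using xy x y by (auto intro!: gp_hyperbolic)
  ultimately have "real i * real h - (1 + 3 * \<delta>) \<le> gp ?x ?y"
    using gp \<delta>_nonneg by linarith
  moreover have "mdist X ?x ?y = 2 * (real i * real h) - 2 * gp ?x ?y"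
    using dist_eq_gp[OF xy(1,2)] xy(3,4) by simp
  ultimately show ?thesis by linarith
qed

text \<open>The hypothesis admits distances up to \<open>2 * h\<close>, twice the bound of the conclusion or more; so
  \<open>p\<close> maps not only adjacent points to adjacent ones but also points with a common neighbour.\<close>

lemma parents_near:
  assumes x: "x \<in> N" and y: "y \<in> N" and k: "k x = k y" "0 < k x"
    and d: "mdist X x y \<le> 2 * real h"
  shows "mdist X (p x) (p y) \<le> 2 + 6 * \<delta>"
proof -
  have "real (k x - 1) * real h \<le> gp x y"
    using d dist_eq_gp[OF x y] k by (simp add: of_nat_diff algebra_simps)
  then show ?thesis
    using ancestors_near[OF x y, of "k x - 1"] k by simp
qed

section \<open>The web of a radial net\<close>

text \<open>The net has points only at levels that are multiples of \<open>h\<close>, so its tree is subdivided: the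
  vertices of level \<open>n\<close> are the pairs \<open>(x, n)\<close> with \<open>x\<close> in the first sphere of the net at distance
  at least \<open>n\<close> from \<open>w\<close>.  This is the sphere with index \<open>block n\<close>, the least \<open>i\<close> with \<open>n \<le> i * h\<close>.\<close>

definition block :: "nat \<Rightarrow> nat" where
  "block n = (n + h - 1) div h"

lemma block_eq_iff: "block n = i \<longleftrightarrow> n \<le> i * h \<and> i * h < n + h"
proof
  assume "block n = i"
  then have "i = (n + h - 1) div h" by (simp add: block_def)
  then have "i * h \<le> n + h - 1" "n + h - 1 < Suc i * h"
    using h_pos div_times_less_eq_dividend dividend_less_times_div
    by (auto simp: algebra_simps intro: dividend_less_div_times)
  then show "n \<le> i * h \<and> i * h < n + h" using h_pos by auto
next
  assume "n \<le> i * h \<and> i * h < n + h"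
  then have "i * h \<le> n + h - 1" "n + h - 1 < Suc i * h" using h_pos by auto
  then show "block n = i"
    unfolding block_def by (intro div_nat_eqI) (auto simp: algebra_simps)
qed

lemma block_upper: "n \<le> block n * h" and block_lower: "block n * h < n + h"
  using block_eq_iff by blast+

lemma block_mult: "block (i * h) = i"
  using h_pos by (simp add: block_eq_iff)

lemma block_0: "block 0 = 0"
  using h_pos by (simp add: block_eq_iff)

lemma block_mono: "m \<le> n \<Longrightarrow> block m \<le> block n"
  unfolding block_def by (intro div_le_mono) simp

lemma block_minus_h: "block (n - h) = block n - 1"
proof (cases "block n")
  case 0
  then show ?thesis using block_mono[of "n - h" n] by simp
next
  case (Suc i)
  then have "n \<le> Suc i * h \<and> Suc i * h < n + h" using block_eq_iff by blast
  then have "block (n - h) = i" by (subst block_eq_iff) auto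
  with Suc show ?thesis by simp
qed

lemma block_minus_1: "block (n - 1) = block n \<or> block (n - 1) = block n - 1"
proof -
  have "block (n - 1) \<le> block n" "block (n - h) \<le> block (n - 1)"
    using h_pos by (auto intro!: block_mono)
  then show ?thesis unfolding block_minus_h by linarith
qed

text \<open>For positive \<open>i\<close>, a point of the net with index \<open>i\<close> accounts for the \<open>h\<close> vertices of levels
  \<open>(i - 1) * h + 1, \<dots>, i * h\<close> on the subdivided edge to its parent.\<close>

definition vertices :: "('a \<times> nat) set" where
  "vertices = {(x, n). x \<in> N \<and> k x = block n}"

text \<open>The exponent is \<open>0\<close> or \<open>1\<close>: the point changes only when the level passes a multiple of \<open>h\<close>.
  Truncated subtraction makes the root its own parent.\<close>

definition parent :: "'a \<times> nat \<Rightarrow> 'a \<times> nat" where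
  "parent = (\<lambda>(x, n). ((p ^^ (k x - block (n - 1))) x, n - 1))"

text \<open>Vertices of the same level are adjacent when their points are; so adjacency is copied along
  subdivided edges.\<close>

definition adjacent :: "'a \<times> nat \<Rightarrow> 'a \<times> nat \<Rightarrow> bool" where
  "adjacent u v \<longleftrightarrow> u \<in> vertices \<and> v \<in> vertices \<and> snd u = snd v
     \<and> mdist X (fst u) (fst v) \<le> 2 + 6 * \<delta>"

lemma ancestor_in:
  assumes "(x, n) \<in> vertices" "m \<le> n"
  shows "((p ^^ (k x - block m)) x, m) \<in> vertices"
  using assms block_mono[OF assms(2)] by (auto simp: vertices_def p_iter_in k_p_iter)

lemma parent_iter:
  assumes v: "(x, n) \<in> vertices"
  shows "(parent ^^ s) (x, n) = ((p ^^ (k x - block (n - s))) x, n - s)"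
proof (induction s)
  case 0
  then show ?case using v by (simp add: vertices_def)
next
  case (Suc s)
  let ?y = "(p ^^ (k x - block (n - s))) x"
  have x: "x \<in> N" "k x = block n" using v by (auto simp: vertices_def)
  have le: "block (n - s) \<le> k x" "block (n - Suc s) \<le> block (n - s)"
    using block_mono x by auto
  have "k ?y = block (n - s)" using x le by (simp add: k_p_iter)
  then have "(parent ^^ Suc s) (x, n)
      = ((p ^^ (block (n - s) - block (n - Suc s))) ?y, n - Suc s)"
    unfolding funpow.simps comp_apply Suc.IH by (simp add: parent_def)
  also have "(p ^^ (block (n - s) - block (n - Suc s))) ?y
      = (p ^^ (block (n - s) - block (n - Suc s) + (k x - block (n - s)))) x"
    by (simp add: funpow_add)
  also have "block (n - s) - block (n - Suc s) + (k x - block (n - s)) = k x - block (n - Suc s)"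
    using le by linarith
  finally show ?case .
qed

lemma adjacent_parent:
  assumes "adjacent u v"
  shows "adjacent (parent u) (parent v)"
proof -
  obtain x n y where uv: "u = (x, n)" "v = (y, n)"
    using assms by (cases u; cases v) (auto simp: adjacent_def)
  have xy: "x \<in> N" "y \<in> N" "k x = block n" "k y = block n" "mdist X x y \<le> 2 + 6 * \<delta>"
    and V: "(x, n) \<in> vertices" "(y, n) \<in> vertices"
    using assms by (auto simp: adjacent_def uv vertices_def)
  have in_V: "parent u \<in> vertices" "parent v \<in> vertices"
    using ancestor_in[OF V(1), of "n - 1"] ancestor_in[OF V(2), of "n - 1"]
    by (simp_all add: uv parent_def)
  have "mdist X (fst (parent u)) (fst (parent v)) \<le> 2 + 6 * \<delta>"
  proof (cases "block (n - 1) = block n")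
    case True
    then show ?thesis using xy(3-5) by (simp add: uv parent_def)
  next
    case False
    then have e: "block n - block (n - 1) = 1" "0 < block n"
      using block_minus_1[of n] by linarith+
    have "mdist X x y \<le> 2 * real h" using xy(5) h_large by simp
    then have "mdist X (p x) (p y) \<le> 2 + 6 * \<delta>"
      using parents_near[OF xy(1,2)] xy(3,4) e(2) by presburger
    then show ?thesis using e(1) xy(3,4) by (simp add: uv parent_def)
  qed
  with in_V show ?thesis by (simp add: adjacent_def uv parent_def)
qed

lemma adjacent_halve:
  assumes "adjacent u v" "adjacent v t"
  shows "adjacent ((parent ^^ h) u) ((parent ^^ h) t)"
proof -
  obtain x n where u: "u = (x, n)" by (cases u)
  obtain y where v: "v = (y, n)" using assms(1) u by (cases v) (simp add: adjacent_def)
  obtain z where t: "t = (z, n)" using assms(2) v by (cases t) (simp add: adjacent_def)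
  note uvt = u v t
  have xyz: "x \<in> N" "y \<in> N" "z \<in> N" "k x = block n" "k z = block n"
      "mdist X x y \<le> 2 + 6 * \<delta>" "mdist X y z \<le> 2 + 6 * \<delta>"
    and V: "(x, n) \<in> vertices" "(z, n) \<in> vertices"
    using assms by (auto simp: adjacent_def uvt vertices_def)
  have d: "mdist X x z \<le> 2 * real h"
    using mdist_triangle[OF xyz(1-3)[THEN in_X]] xyz(6,7) h_large by linarith
  have "mdist X ((p ^^ (block n - (block n - 1))) x) ((p ^^ (block n - (block n - 1))) z)
      \<le> 2 + 6 * \<delta>"
  proof (cases "block n = 0")
    case True
    then have "x = w" "z = w" using xyz(1,3,4,5) k_eq_0 by auto
    moreover have "mdist X w w = 0" using in_X[OF base_in] by simp
    ultimately show ?thesis using True \<delta>_nonneg by simp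
  next
    case False
    then have "block n - (block n - 1) = 1" by simp
    moreover have "mdist X (p x) (p z) \<le> 2 + 6 * \<delta>"
      using parents_near[OF xyz(1,3) _ _ d] xyz(4,5) False by simp
    ultimately show ?thesis by (simp only: One_nat_def funpow.simps comp_apply id_apply)
  qed
  then show ?thesis
    using ancestor_in[OF V(1), of "n - h"] ancestor_in[OF V(2), of "n - h"] xyz(4,5)
    by (simp add: uvt parent_iter[OF V(1)] parent_iter[OF V(2)] adjacent_def block_minus_h)
qed

lemma vertices_climb:
  assumes "v \<in> vertices"
  shows "mdist X (fst v) (fst ((parent ^^ s) v)) \<le> real s + 4 * real h"
proof -
  obtain x n where v: "v = (x, n)" by (cases v)
  have V: "(x, n) \<in> vertices" using assms v by simp
  then have x: "x \<in> N" "k x = block n" by (auto simp: vertices_def)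
  let ?e = "k x - block (n - s)"
  have le: "block (n - s) \<le> block n" by (intro block_mono) simp
  have "?e * h = block n * h - block (n - s) * h" by (simp add: x diff_mult_distrib)
  also have "\<dots> \<le> s + h"
    using block_upper[of "n - s"] block_lower[of n] by linarith
  finally have "real ?e * real h \<le> real s + real h"
    by (metis of_nat_add of_nat_le_iff of_nat_mult)
  moreover have "mdist X x ((p ^^ ?e) x) \<le> real ?e * real h + 2 + 2 * \<delta>"
    by (rule dist_p_iter[OF x(1)]) simp
  ultimately show ?thesis using h_large \<delta>_nonneg by (simp add: v parent_iter[OF V])
qed

text \<open>Let \<open>j\<close> be the greatest number such that \<open>j * h\<close> does not exceed the Gromov product of the points.
  The ancestors are taken at level \<open>(j - 1) * h\<close>, with truncated subtraction.  The level \<open>j * h\<close> itself could be too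
  large, because a vertex may have up to \<open>h - 1\<close> levels less than its point.\<close>

lemma vertices_meet:
  assumes "u \<in> vertices" "v \<in> vertices"
  shows "\<exists>s t. adjacent ((parent ^^ s) u) ((parent ^^ t) v)
    \<and> real (s + t) \<le> mdist X (fst u) (fst v) + 4 * real h"
proof -
  obtain x n y m where uv: "u = (x, n)" "v = (y, m)" by (cases u; cases v)
  have V: "(x, n) \<in> vertices" "(y, m) \<in> vertices" using assms uv by auto
  then have xy: "x \<in> N" "y \<in> N" "k x = block n" "k y = block m" by (auto simp: vertices_def)
  define j where "j = nat \<lfloor>gp x y / real h\<rfloor>"
  define i where "i = j - 1"
  have tri: "mdist X w x \<le> mdist X w y + mdist X y x" "mdist X w y \<le> mdist X w x + mdist X x y"
      "mdist X x y \<le> mdist X x w + mdist X w y"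
    using xy base_in by (auto intro!: mdist_triangle in_X)
  have gp_bounds: "0 \<le> gp x y" "gp x y \<le> real (k x) * real h" "gp x y \<le> real (k y) * real h"
    using tri unfolding dist_base[OF xy(1), symmetric] dist_base[OF xy(2), symmetric]
      gromov_product_def by (simp_all add: mdist_commute)
  have j: "real j * real h \<le> gp x y" "gp x y < (real j + 1) * real h"
    using gp_bounds(1) h_pos unfolding j_def
    by (simp_all add: pos_le_divide_eq[symmetric] pos_divide_less_eq[symmetric] del: of_nat_Suc)
  have "real j * real h \<le> real (k x) * real h" "real j * real h \<le> real (k y) * real h"
    using j(1) gp_bounds by linarith+
  then have jk: "j \<le> k x" "j \<le> k y" using h_pos by auto
  have i_le: "i * h \<le> l" if "j \<le> block l" for l
  proof (cases j)
    case 0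
    then show ?thesis by (simp add: i_def)
  next
    case (Suc j')
    have "Suc j' * h \<le> block l * h" using that Suc by (intro mult_right_mono) auto
    then show ?thesis using block_lower[of l] Suc by (simp add: i_def)
  qed
  have nm: "i * h \<le> n" "i * h \<le> m" using i_le jk xy by auto
  have "real i * real h \<le> real j * real h" by (intro mult_right_mono) (auto simp: i_def)
  then have "mdist X ((p ^^ (k x - i)) x) ((p ^^ (k y - i)) y) \<le> 2 + 6 * \<delta>"
    using j(1) jk xy by (intro ancestors_near) (auto simp: i_def)
  then have adj: "adjacent ((parent ^^ (n - i * h)) u) ((parent ^^ (m - i * h)) v)"
    using ancestor_in[OF V(1) nm(1)] ancestor_in[OF V(2) nm(2)] nm
    by (simp add: uv parent_iter[OF V(1)] parent_iter[OF V(2)] adjacent_def block_mult)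
  have "real n \<le> real (k x) * real h" "real m \<le> real (k y) * real h"
    using block_upper xy by (metis of_nat_le_iff of_nat_mult)+
  moreover have "gp x y - 2 * real h \<le> real i * real h"
  proof -
    have "(real j + 1) * real h \<le> (real i + 2) * real h"
      by (intro mult_right_mono) (auto simp: i_def)
    then show ?thesis using j(2) by (simp add: algebra_simps)
  qed
  moreover have "real (n - i * h) = real n - real i * real h"
      "real (m - i * h) = real m - real i * real h"
    unfolding of_nat_diff[OF nm(1)] of_nat_diff[OF nm(2)] of_nat_mult by (rule refl)+
  ultimately have "real (n - i * h + (m - i * h)) \<le> mdist X x y + 4 * real h"
    unfolding of_nat_add dist_eq_gp[OF xy(1,2)] by argo
  with adj show ?thesis unfolding uv fst_conv by blast
qed

lemma vertices_fibre:
  "finite {v \<in> vertices. fst v = x} \<and> card {v \<in> vertices. fst v = x} \<le> h"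
proof -
  have sub: "{v \<in> vertices. fst v = x} \<subseteq> (\<lambda>i. (x, k x * h - i)) ` {..<h}"
  proof
    fix v assume "v \<in> {v \<in> vertices. fst v = x}"
    then obtain n where n: "v = (x, n)" "k x = block n" by (auto simp: vertices_def)
    then have "n = k x * h - (k x * h - n)" "k x * h - n < h"
      using block_upper[of n] block_lower[of n] h_pos by auto
    then show "v \<in> (\<lambda>i. (x, k x * h - i)) ` {..<h}" using n(1) by blast
  qed
  have "card {v \<in> vertices. fst v = x} \<le> card ((\<lambda>i. (x, k x * h - i)) ` {..<h})"
    by (rule card_mono[OF _ sub]) simp
  also have "\<dots> \<le> h" using card_image_le[of "{..<h}"] by simp
  finally show ?thesis using finite_subset[OF sub] by simp
qed

lemma finite_vertices_level: "finite {v \<in> vertices. snd v = n}"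
proof (rule finite_subset)
  show "{v \<in> vertices. snd v = n} \<subseteq> {x \<in> N. k x = block n} \<times> {n}"
    by (auto simp: vertices_def)
qed (use net_finite in auto)

lemma countable_vertices: "countable vertices"
proof -
  have "vertices = (\<Union>n. {v \<in> vertices. snd v = n})" by auto
  moreover have "countable (\<Union>n. {v \<in> vertices. snd v = n})"
    by (rule countable_UN) (auto intro: countable_finite finite_vertices_level)
  ultimately show ?thesis by simp
qed

lemma coarse_web_vertices:
  "coarse_web vertices (w, 0) snd parent adjacent X fst h (2 + 6 * \<delta>) (4 * real h)"
proof
  show "(w, 0) \<in> vertices" using base_in by (simp add: vertices_def k_base block_0)
  show "parent v \<in> vertices" if "v \<in> vertices" for v
    using that ancestor_in[of "fst v" "snd v" "snd v - 1"] by (cases v) (simp add: parent_def)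
  show "parent (w, 0) = (w, 0)" by (simp add: parent_def k_base)
  show "snd v = Suc (snd (parent v))" if "v \<in> vertices" "v \<noteq> (w, 0)" for v
    using that k_eq_0 block_0 by (cases v; cases "snd v") (auto simp: parent_def vertices_def)
  show "finite {v \<in> vertices. snd v = n}" for n by (rule finite_vertices_level)
  show "adjacent v v" if v: "v \<in> vertices" for v
  proof -
    have "mdist X (fst v) (fst v) = 0" using v in_X by (auto simp: vertices_def)
    then show ?thesis using v \<delta>_nonneg by (simp add: adjacent_def)
  qed
  show "\<exists>v\<in>vertices. mdist X (fst v) z \<le> 4 * real h" if "z \<in> mspace X" for z
  proof -
    obtain y where y: "y \<in> N" "mdist X y z \<le> real h + 2" using net_dense \<open>z \<in> mspace X\<close> by blast
    then have "(y, k y * h) \<in> vertices" by (simp add: vertices_def block_mult)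
    then show ?thesis using y h_large \<delta>_nonneg by (intro bexI[of _ "(y, k y * h)"]) auto
  qed
  show "fst v \<in> mspace X" if "v \<in> vertices" for v
    using that in_X by (auto simp: vertices_def)
  show "2 \<le> mdist X (fst u) (fst v)" if "u \<in> vertices" "v \<in> vertices" "fst u \<noteq> fst v" for u v
    using that net_separated by (auto simp: vertices_def)
  show "adjacent v u" if "adjacent u v" for u v
    using that by (simp add: adjacent_def mdist_commute)
  show "adjacent ((parent ^^ h) u) ((parent ^^ h) t)" if "adjacent u v" "adjacent v t" for u v t
    using that by (rule adjacent_halve)
  show "adjacent (parent u) (parent v)" if "adjacent u v" for u v
    using that by (rule adjacent_parent)
  show "\<exists>s t. adjacent ((parent ^^ s) u) ((parent ^^ t) v)
      \<and> real (s + t) \<le> mdist X (fst u) (fst v) + 4 * real h"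
    if "u \<in> vertices" "v \<in> vertices" for u v
    using that by (rule vertices_meet)
  show "mdist X (fst v) (fst ((parent ^^ s) v)) \<le> real s + 4 * real h" if "v \<in> vertices" for v s
    using that by (rule vertices_climb)
  show "finite {v \<in> vertices. fst v = x}" "card {v \<in> vertices. fst v = x} \<le> h" for x
    using vertices_fibre by auto
qed (simp_all add: adjacent_def h_pos)

end

text \<open>The net is a maximal \<open>2\<close>-separated subset of the union of the spheres of radius in \<open>h * \<nat>\<close>.
  Since \<open>h \<ge> 2\<close>, it is maximal on each sphere separately.\<close>

lemma radial_net_exists:
  assumes X: "class_X \<delta> a b X \<mu>" and \<delta>: "0 \<le> \<delta>" and ab: "0 < a" "0 < b"
  shows "\<exists>w h N k p. radial_net X \<delta> w h N k p"
proof -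
  have intrinsic: "strictly_intrinsic X" and hyp: "gromov_hyperbolic \<delta> X"
    and borel: "borel_measure_on X \<mu>" and growth: "pinched_exp_growth a b X \<mu>"
    and noncompact: "\<not> compact_space (mtopology_of X)"
    using X by (auto simp: class_X_def)
  have "mspace X \<noteq> {}"
    using noncompact by (metis compact_space_def compactin_empty topspace_mtopology_of)
  then obtain w where w: "w \<in> mspace X" by blast
  have ww: "mdist X w w = 0" using w by simp
  define h where "h = nat \<lceil>2 + 6 * \<delta>\<rceil>"
  have h: "2 + 6 * \<delta> \<le> real h" by (simp add: h_def real_nat_ceiling_ge)
  then have h2: "2 \<le> real h" using \<delta> by linarith
  define A where "A = {x \<in> mspace X. \<exists>j. mdist X w x = real j * real h}"
  obtain N where N: "N \<subseteq> A" "\<And>x y. x \<in> N \<Longrightarrow> y \<in> N \<Longrightarrow> x \<noteq> y \<Longrightarrow> 2 \<le> mdist X x y"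
      "\<And>x. x \<in> A \<Longrightarrow> \<exists>y\<in>N. x = y \<or> mdist X x y < 2"
    by (rule maximal_separated_subset[of A 2 X]) blast
  define k where "k x = (SOME j. mdist X w x = real j * real h)" for x
  have k: "mdist X w x = real (k x) * real h" if "x \<in> A" for x
    using that unfolding k_def A_def by (auto intro: someI)
  have N_in: "x \<in> mspace X" if "x \<in> N" for x using that N(1) by (auto simp: A_def)
  have net: "\<exists>y\<in>N. mdist X z y < 2 \<and> k y = j"
    if z: "z \<in> mspace X" "mdist X w z = real j * real h" for z j
  proof -
    have "z \<in> A" using z by (auto simp: A_def)
    then obtain y where y: "y \<in> N" "z = y \<or> mdist X z y < 2" using N(3) by blast
    moreover have "mdist X z z = 0" using z by simp
    ultimately have d: "mdist X z y < 2" by auto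
    have dist_y: "mdist X w y = real (k y) * real h" using k N(1) y(1) by blast
    have "mdist X w y \<le> mdist X w z + mdist X z y" "mdist X w z \<le> mdist X w y + mdist X y z"
      using w z(1) N_in[OF y(1)] by (auto intro!: mdist_triangle)
    then have "\<bar>real (k y) * real h - real j * real h\<bar> < real h"
      using d h2 mdist_commute[of X z y] unfolding z(2) dist_y by linarith
    then have "\<bar>real (k y) - real j\<bar> * real h < 1 * real h"
      by (simp flip: left_diff_distrib add: abs_mult)
    then have "\<bar>real (k y) - real j\<bar> < 1" using h2 by simp
    then show ?thesis using y d by (intro bexI[of _ y]) auto
  qed
  have "\<exists>y\<in>N. mdist X w y < 2 \<and> k y = 0"
    using net[of w 0] w ww by simp
  then obtain y where "y \<in> N" "k y = 0" by blast
  then have w_in: "w \<in> N"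
    using k[of y] N(1) N_in[of y] w by auto
  have "\<exists>y. y \<in> N \<and> k y = k x - 1 \<and> mdist X x y \<le> real h + 2 \<and> (x = w \<longrightarrow> y = w)"
    if x: "x \<in> N" for x
  proof (cases "x = w")
    case True
    have "k w = 0" using k[of w] N(1) w_in ww h2 by auto
    then show ?thesis using True w_in ww by auto
  next
    case False
    have d: "mdist X w x = real (k x) * real h" using k x N(1) by auto
    with False have kx: "0 < k x" using w N_in[OF x] by (cases "k x") auto
    have le: "real (k x - 1) * real h \<le> mdist X w x"
      unfolding d by (intro mult_right_mono) auto
    obtain z where z: "z \<in> mspace X" "mdist X w z = real (k x - 1) * real h"
        "mdist X z x = mdist X w x - real (k x - 1) * real h"
      by (rule strictly_intrinsic_point_between[OF intrinsic w N_in[OF x] _ le]) simp_all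
    obtain y where y: "y \<in> N" "mdist X z y < 2" "k y = k x - 1" using net[OF z(1,2)] by blast
    have "mdist X z x = real h" using z(3) d kx by (simp add: of_nat_diff algebra_simps)
    then have "mdist X x y \<le> real h + 2"
      using mdist_triangle[OF N_in[OF x] z(1) N_in[OF y(1)]] y(2) by (simp add: mdist_commute)
    with y False show ?thesis by blast
  qed
  then obtain p where p: "\<And>x. x \<in> N \<Longrightarrow> p x \<in> N \<and> k (p x) = k x - 1
      \<and> mdist X x (p x) \<le> real h + 2 \<and> (x = w \<longrightarrow> p x = w)"
    by metis
  obtain c C where cC: "0 < c" "0 < C"
    and lower: "\<And>x r. x \<in> mspace X \<Longrightarrow> 1 \<le> r \<Longrightarrow>
      ennreal (c * a powr r) \<le> emeasure \<mu> (mball_of X x r)"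
    and upper: "\<And>x r. x \<in> mspace X \<Longrightarrow> 1 \<le> r \<Longrightarrow>
      emeasure \<mu> (mball_of X x r) \<le> ennreal (C * b powr r)"
    using growth unfolding pinched_exp_growth_def by blast
  have "radial_net X \<delta> w h N k p"
  proof
    show "finite {x \<in> N. k x = n}" for n
    proof -
      have "finite {x \<in> N. k x = n} \<and> real (card {x \<in> N. k x = n})
          \<le> C * b powr ((real n * real h + 1) + 1) / (c * a)"
      proof (rule separated_card_bound[OF borel lower upper ab cC w])
        show "{x \<in> N. k x = n} \<subseteq> mball_of X w (real n * real h + 1)"
          using w N_in N(1) k by auto
      qed (use N(2) in auto)
      then show ?thesis by blast
    qed
    show "\<exists>y\<in>N. mdist X y z \<le> real h + 2" if z: "z \<in> mspace X" for z
    proof -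
      define j where "j = nat \<lfloor>mdist X w z / real h\<rfloor>"
      have j: "real j * real h \<le> mdist X w z" "mdist X w z < (real j + 1) * real h"
        using h2 unfolding j_def
        by (simp_all add: pos_le_divide_eq[symmetric] pos_divide_less_eq[symmetric]
            del: of_nat_Suc)
      obtain z' where z': "z' \<in> mspace X" "mdist X w z' = real j * real h"
          "mdist X z' z = mdist X w z - real j * real h"
        using strictly_intrinsic_point_between[OF intrinsic w z _ j(1)] by auto
      obtain y where y: "y \<in> N" "mdist X z' y < 2" using net[OF z'(1,2)] by blast
      have "mdist X y z \<le> mdist X y z' + mdist X z' z"
        using N_in[OF y(1)] z z'(1) by (intro mdist_triangle)
      then show ?thesis
        using y z'(3) j(2) by (intro bexI[of _ y]) (auto simp: mdist_commute algebra_simps)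
    qed
  qed (use hyp \<delta> w_in N_in h k N(1,2) p in auto)
  then show ?thesis by blast
qed

theorem theorem5p1:
  fixes \<delta> a b :: real and X :: "'a metric" and \<mu> :: "'a measure"
  assumes "0 < \<delta>" and "0 < a" and "0 < b"
    and "1 < a" and "a \<le> b"
    and "class_X \<delta> a b X \<mu>"
  shows "\<exists>\<delta>'>0. \<exists>(V :: nat set) (E :: nat set set).
           class_Upsilon \<delta>' a b V E \<and>
           strictly_roughly_isometric (graph_metric V E) X"
proof -
  have X: "gromov_hyperbolic \<delta> X" "borel_measure_on X \<mu>" "pinched_exp_growth a b X \<mu>"
    using assms(6) by (auto simp: class_X_def)
  obtain w h N k p where "radial_net X \<delta> w h N k p"
    using radial_net_exists[OF assms(6)] assms by auto
  then interpret net: radial_net X \<delta> w h N k p .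
  interpret web: coarse_web
    "to_nat_on net.vertices ` net.vertices" "to_nat_on net.vertices (w, 0)"
    "snd \<circ> inv_into net.vertices (to_nat_on net.vertices)"
    "to_nat_on net.vertices \<circ> net.parent \<circ> inv_into net.vertices (to_nat_on net.vertices)"
    "\<lambda>u v. u \<in> to_nat_on net.vertices ` net.vertices \<and> v \<in> to_nat_on net.vertices ` net.vertices
      \<and> net.adjacent (inv_into net.vertices (to_nat_on net.vertices) u)
          (inv_into net.vertices (to_nat_on net.vertices) v)"
    X "fst \<circ> inv_into net.vertices (to_nat_on net.vertices)" h "2 + 6 * \<delta>" "4 * real h"
    by (rule coarse_web_transfer[OF net.coarse_web_vertices
          inj_on_to_nat_on[OF net.countable_vertices]])
  have "0 < \<delta> + 3 * web.distortion"
    using assms(1) web.distortion_nonneg by simp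
  then show ?thesis
    using web.class_Upsilon_web[OF X assms(4,5)] web.strict_rough_isometry_web
    unfolding strictly_roughly_isometric_def by blast
qed

end
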